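(* Let $d\ge0$ be an integer and let $$G=\langle x_0\mid x_0^2\rangle*\langle x_1\mid x_1^2\rangle*\cdots*\langle x_d\mid x_d^2\rangle$$ be the free product, in the category of pro-$2$-groups, of $d+1$ copies of the cyclic group $C_2$ of order $2$. For $i=1,\dots,d$ put $y_i=x_0x_i\in G$, and let $H$ be the closed subgroup of $G$ generated by $y_1,\dots,y_d$. Let $n\ge2$ be an integer. Then: (1) $H_{(n)}=H\cap G_{(n)}$. (2) $G/G_{(n)}\simeq H/H_{(n)}\rtimes C_2$, where, writing $\bar x$ for the generator of $C_2$ and $\bar y_i$ for the image of $y_i$ in $H/H_{(n)}$, the action of $C_2$ on $H/H_{(n)}$ is given by $\bar x\bar y_i\bar x=\bar y_i^{-1}$ for $i=1,\dots,d$.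
   Context: For a pro-$2$-group $G$, the Zassenhaus ($2$-)filtration $(G_{(n)})_{n\ge1}$ is defined by $G_{(1)}=G$ and, for $n\ge2$, $G_{(n)}=G_{(\lceil n/2\rceil)}^2\prod_{i+j=n}[G_{(i)},G_{(j)}]$ (with $i,j\ge1$), where for closed subgroups $A,B$, $[A,B]$ is the smallest closed subgroup containing all commutators $[x,y]=x^{-1}y^{-1}xy$ with $x\in A,y\in B$, and $A^2$ is the smallest closed subgroup containing all squares of elements of $A$. $H_{(n)}$ denotes the Zassenhaus filtration of the pro-$2$-group $H$ itself. *)

theory Defs
  imports "HOL-Analysis.Analysis" "HOL-Algebra.Elementary_Groups" "HOL-Algebra.Bij"
begin

section \<open>Pro-2-groups\<close>

text \<open>A topological group is a pair of a group \<open>G\<close> and a topology \<open>T\<close> on its carrier.\<close>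

definition topological_group :: "('a, 'm) monoid_scheme \<Rightarrow> 'a topology \<Rightarrow> bool" where
  "topological_group G T \<longleftrightarrow>
     group G \<and> topspace T = carrier G \<and>
     continuous_map (prod_topology T T) T (\<lambda>(a, b). a \<otimes>\<^bsub>G\<^esub> b) \<and>
     continuous_map T T (\<lambda>a. inv\<^bsub>G\<^esub> a)"

text \<open>The third line below says that the space is totally disconnected, so the first three
  lines say that \<open>G\<close> is profinite.\<close>

definition pro2_group :: "('a, 'm) monoid_scheme \<Rightarrow> 'a topology \<Rightarrow> bool" where
  "pro2_group G T \<longleftrightarrow>
     topological_group G T \<and>
     compact_space T \<and> Hausdorff_space T \<and>
     (\<forall>S. connectedin T S \<longrightarrow> (\<exists>a. S \<subseteq> {a})) \<and>
     (\<forall>N. N \<lhd> G \<and> openin T N \<longrightarrow> (\<exists>k. card (rcosets\<^bsub>G\<^esub> N) = 2 ^ k))"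

definition continuous_hom ::
  "('a, 'm) monoid_scheme \<Rightarrow> 'a topology \<Rightarrow> ('b, 'n) monoid_scheme \<Rightarrow> 'b topology \<Rightarrow> ('a \<Rightarrow> 'b) set"
  where "continuous_hom G T K S = {f \<in> hom G K. continuous_map T S f}"

definition topologically_isomorphic ::
  "('a, 'm) monoid_scheme \<Rightarrow> 'a topology \<Rightarrow> ('b, 'n) monoid_scheme \<Rightarrow> 'b topology \<Rightarrow> bool"
  where "topologically_isomorphic G T K S \<longleftrightarrow> (\<exists>f \<in> iso G K. homeomorphic_map T S f)"

definition closed_subgroup_generated ::
  "('a, 'm) monoid_scheme \<Rightarrow> 'a topology \<Rightarrow> 'a set \<Rightarrow> 'a set"
  where "closed_subgroup_generated G T S = (\<lambda>K. subgroup K G \<and> closedin T K) hull S"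

definition quotient_group_topology ::
  "('a, 'm) monoid_scheme \<Rightarrow> 'a topology \<Rightarrow> 'a set \<Rightarrow> 'a set topology"
  where "quotient_group_topology G T N =
    topology (\<lambda>U. U \<subseteq> rcosets\<^bsub>G\<^esub> N \<and> openin T {a \<in> carrier G. N #>\<^bsub>G\<^esub> a \<in> U})"

lemma openin_quotient_group_topology:
  assumes "topspace T = carrier G"
  shows "openin (quotient_group_topology G T N) U \<longleftrightarrow>
    U \<subseteq> rcosets\<^bsub>G\<^esub> N \<and> openin T {a \<in> carrier G. N #>\<^bsub>G\<^esub> a \<in> U}"
proof -
  let ?P = "\<lambda>U. {a \<in> carrier G. N #>\<^bsub>G\<^esub> a \<in> U}"
  have int: "?P (A \<inter> B) = ?P A \<inter> ?P B" for A B by blast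
  have un: "?P (\<Union>K) = \<Union>(?P ` K)" for K by blast
  have "istopology (\<lambda>U. U \<subseteq> rcosets\<^bsub>G\<^esub> N \<and> openin T (?P U))"
    unfolding istopology_def int un by (auto intro: openin_Int)
  then show ?thesis
    unfolding quotient_group_topology_def by (simp add: topology_inverse')
qed

section \<open>Free products in the category of pro-2-groups\<close>

text \<open>
  The universal property of the coproduct \<open>(G, \<iota>)\<close> of the family \<open>A\<close> of pro-2-groups,
  tested on the pro-2-groups \<open>P\<close> whose elements have type \<open>'b\<close> (a HOL formula cannot quantify
  over types).  No generality is lost as long as, up to isomorphism, \<open>'b\<close> accommodates
  every pro-2-group that is topologically generated by images of the \<open>A i\<close>, because the maps
  in question factor through the closed subgroup generated by these images.  If finitely
  many topologically finitely generated groups are multiplied, these groups have at most the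
  cardinality of the continuum, and \<open>'b = nat set\<close> is large enough.
\<close>

definition pro2_free_product ::
  "'b itself \<Rightarrow> 'i set \<Rightarrow> ('i \<Rightarrow> 'c monoid) \<Rightarrow> ('i \<Rightarrow> 'c topology) \<Rightarrow>
   ('i \<Rightarrow> 'c \<Rightarrow> 'a) \<Rightarrow> ('a, 'm) monoid_scheme \<Rightarrow> 'a topology \<Rightarrow> bool"
  where "pro2_free_product _ I A TA \<iota> G T \<longleftrightarrow>
    pro2_group G T \<and>
    (\<forall>i\<in>I. \<iota> i \<in> continuous_hom (A i) (TA i) G T) \<and>
    (\<forall>(P :: 'b monoid) TP f.
       pro2_group P TP \<and> (\<forall>i\<in>I. f i \<in> continuous_hom (A i) (TA i) P TP) \<longrightarrow>
       (\<exists>!g. g \<in> extensional (carrier G) \<and> g \<in> continuous_hom G T P TP \<and>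
             (\<forall>i\<in>I. \<forall>a\<in>carrier (A i). g (\<iota> i a) = f i a)))"

text \<open>The cyclic group of order 2 has elements \<open>0\<close> (neutral) and \<open>1\<close> (generator).\<close>

abbreviation C2 :: "int monoid" where
  "C2 \<equiv> integer_mod_group 2"

abbreviation C2_top :: "int topology" where
  "C2_top \<equiv> discrete_topology (carrier C2)"

section \<open>The Zassenhaus filtration\<close>

definition closed_squares :: "('a, 'm) monoid_scheme \<Rightarrow> 'a topology \<Rightarrow> 'a set \<Rightarrow> 'a set" where
  "closed_squares G T A = closed_subgroup_generated G T {a \<otimes>\<^bsub>G\<^esub> a | a. a \<in> A}"

definition closed_commutators ::
  "('a, 'm) monoid_scheme \<Rightarrow> 'a topology \<Rightarrow> 'a set \<Rightarrow> 'a set \<Rightarrow> 'a set" where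
  "closed_commutators G T A B = closed_subgroup_generated G T
     {inv\<^bsub>G\<^esub> a \<otimes>\<^bsub>G\<^esub> inv\<^bsub>G\<^esub> b \<otimes>\<^bsub>G\<^esub> a \<otimes>\<^bsub>G\<^esub> b | a b. a \<in> A \<and> b \<in> B}"

text \<open>
  \<open>(n + 1) div 2\<close> is the ceiling of \<open>n / 2\<close>, and the \<open>foldr\<close> is the product of the sets
  \<open>[G_(i), G_(n-i)]\<close> for \<open>i = 1, ..., n - 1\<close>; as the factors are normal subgroups, the order
  does not matter.  Only \<open>n \<ge> 1\<close> is meaningful; the value at \<open>0\<close> is a dummy.
\<close>

function zassenhaus_filtration ::
  "('a, 'm) monoid_scheme \<Rightarrow> 'a topology \<Rightarrow> nat \<Rightarrow> 'a set" where
  "zassenhaus_filtration G T n =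
     (if n \<le> 1 then carrier G
      else closed_squares G T (zassenhaus_filtration G T ((n + 1) div 2)) <#>\<^bsub>G\<^esub>
           foldr (set_mult G)
             (map (\<lambda>i. closed_commutators G T (zassenhaus_filtration G T i)
                         (zassenhaus_filtration G T (n - i))) [1..<n])
             {\<one>\<^bsub>G\<^esub>})"
  by pat_completeness auto
termination by (relation "Wellfounded.measure (\<lambda>(G, T, n). n)") auto

declare zassenhaus_filtration.simps [simp del]

section \<open>Semidirect products\<close>

text \<open>\<open>N \<rtimes> K\<close> for an action \<open>\<phi>\<close> of \<open>K\<close> on \<open>N\<close>, i.e. \<open>\<phi> \<in> hom K (AutoGroup N)\<close>; conjugation
  by \<open>(\<one>, k)\<close> maps \<open>(a, \<one>)\<close> to \<open>(\<phi> k a, \<one>)\<close>.\<close>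

definition semidirect_product ::
  "('a, 'm) monoid_scheme \<Rightarrow> ('b \<Rightarrow> 'a \<Rightarrow> 'a) \<Rightarrow> ('b, 'n) monoid_scheme \<Rightarrow> ('a \<times> 'b) monoid"
  where "semidirect_product N \<phi> K =
    \<lparr>carrier = carrier N \<times> carrier K,
     monoid.mult = (\<lambda>(a, k) (b, l). (a \<otimes>\<^bsub>N\<^esub> \<phi> k b, k \<otimes>\<^bsub>K\<^esub> l)),
     one = (\<one>\<^bsub>N\<^esub>, \<one>\<^bsub>K\<^esub>)\<rparr>"

end

theory Submission
  imports Defs "HOL-Algebra.Weak_Morphisms" "HOL-Algebra.SndIsomorphismGrp"
begin

text \<open>
  The subgroup \<open>H\<close> has index two in \<open>G\<close>, with complement generated by \<open>x 0\<close>, and conjugation by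
  \<open>x 0\<close> inverts every \<open>y i\<close>.  As inversion is trivial modulo squares, this conjugation is trivial
  on \<open>H\<close> modulo the second term of the Zassenhaus filtration of \<open>H\<close>.  The filtration is built from
  its first factor by squares and commutators, so conjugation by \<open>x 0\<close> is trivial on all factors
  (\<open>trivial_action_on_factors\<close>).  In other words, commutators of \<open>x 0\<close> with the \<open>n\<close>-th term fall
  into the next term, and the elements of \<open>G\<close> outside \<open>H\<close> contribute nothing new: the filtrations
  of \<open>G\<close> and \<open>H\<close> coincide from the second term on (\<open>Z_eq_Z_GH\<close>).  This contains the first claim.
  The second follows, since dividing the semidirect product of \<open>H\<close> and the group generated by
  \<open>x 0\<close> by the normal subgroup \<open>Hn\<close>, which lies in \<open>H\<close>, leaves a semidirect product
  (\<open>topologically_isomorphic_semidirect_product\<close>).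

  The universal property of the free product is needed to see that \<open>H\<close> has index two
  (\<open>free_product_index_two_split\<close>).  It provides a character of order two that is nontrivial at
  every \<open>x i\<close> and so trivial on \<open>H\<close>, which excludes \<open>x 0\<close> from \<open>H\<close>.  Moreover, it implies that
  \<open>G\<close> is topologically generated by the \<open>x i\<close> (\<open>free_product_topologically_generated\<close>).  Here one
  has to refute that the \<open>x i\<close> lie in a proper closed subgroup.  Such a subgroup is still proper
  in a finite quotient \<open>Q\<close> of \<open>G\<close>, and any proper subgroup of a finite 2-group \<open>Q\<close> is the set
  where two homomorphisms into the 2-group \<open>C\<^sub>2 \<wr> Q\<close> agree (\<open>separate_from_subgroup\<close>), so that
  uniqueness in the universal property would be violated.
\<close>

section \<open>Compact groups and their closed subgroups\<close>

locale compact_group = group G for G (structure) +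
  fixes T :: "'a topology"
  assumes topological_group: "topological_group G T"
    and compact: "compact_space T"
    and Hausdorff: "Hausdorff_space T"
begin

abbreviation closed_subgroup :: "'a set \<Rightarrow> bool" where
  "closed_subgroup K \<equiv> subgroup K G \<and> closedin T K"

abbreviation closed_normal :: "'a set \<Rightarrow> bool" where
  "closed_normal N \<equiv> N \<lhd> G \<and> closedin T N"

abbreviation csg :: "'a set \<Rightarrow> 'a set" where
  "csg S \<equiv> closed_subgroup_generated G T S"

lemma topspace [simp]: "topspace T = carrier G"
  using topological_group by (simp add: topological_group_def)

lemma continuous_map_mult:
  assumes "continuous_map X T f" "continuous_map X T g"
  shows "continuous_map X T (\<lambda>a. f a \<otimes> g a)"
proof -
  have "continuous_map (prod_topology T T) T (\<lambda>(a, b). a \<otimes> b)"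
    using topological_group by (simp add: topological_group_def)
  from continuous_map_compose[OF continuous_map_pairedI[OF assms] this] show ?thesis
    by (simp add: o_def)
qed

lemma continuous_map_inv:
  assumes "continuous_map X T f"
  shows "continuous_map X T (\<lambda>a. inv (f a))"
proof -
  have "continuous_map T T (\<lambda>a. inv a)"
    using topological_group by (simp add: topological_group_def)
  from continuous_map_compose[OF assms this] show ?thesis
    by (simp add: o_def)
qed

lemma closed_subgroup_carrier: "closed_subgroup (carrier G)"
  using subgroup_self closedin_topspace[of T] by simp

lemma closed_subgroup_csg:
  assumes "S \<subseteq> carrier G"
  shows "closed_subgroup (csg S)"
proof -
  let ?F = "{K. closed_subgroup K \<and> S \<subseteq> K}"
  have "?F \<noteq> {}"
    using closed_subgroup_carrier assms by blast
  then have "subgroup (\<Inter>?F) G" "closedin T (\<Inter>?F)"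
    by (blast intro: subgroups_Inter closedin_Inter)+
  then show ?thesis
    by (simp add: closed_subgroup_generated_def hull_def)
qed

lemma csg_superset: "S \<subseteq> csg S"
  unfolding closed_subgroup_generated_def by (rule hull_subset)

lemma csg_least: "S \<subseteq> K \<Longrightarrow> closed_subgroup K \<Longrightarrow> csg S \<subseteq> K"
  unfolding closed_subgroup_generated_def by (rule hull_minimal)

lemma csg_mono: "S \<subseteq> S' \<Longrightarrow> csg S \<subseteq> csg S'"
  unfolding closed_subgroup_generated_def by (rule hull_mono)

text \<open>
  The device for proving that a property holds on a closed subgroup given by generators: the
  elements with the property are often the preimage of a closed subgroup under a continuous
  homomorphism, and then minimality of the generated subgroup leaves only the generators to check.
\<close>

lemma closed_subgroup_vimage:
  assumes f: "f \<in> continuous_hom G T K S" and "group K" and "subgroup L K" and "closedin S L"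
  shows "closed_subgroup {a \<in> carrier G. f a \<in> L}"
proof -
  interpret f: group_hom G K f
    using f \<open>group K\<close> by (simp add: continuous_hom_def group_hom_def group_hom_axioms_def)
  interpret L: subgroup L K by fact
  have "\<one> \<in> {a \<in> carrier G. f a \<in> L}"
    by simp
  then have "subgroup {a \<in> carrier G. f a \<in> L} G"
    by (intro subgroupI) auto
  moreover have "closedin T {a \<in> topspace T. f a \<in> L}"
    using f \<open>closedin S L\<close> closedin_continuous_map_preimage[of T S f L]
    by (simp add: continuous_hom_def)
  ultimately show ?thesis by simp
qed

lemma conjugation_continuous_hom:
  assumes "g \<in> carrier G"
  shows "(\<lambda>a. g \<otimes> a \<otimes> inv g) \<in> continuous_hom G T G T"
proof -
  have "g \<otimes> (a \<otimes> b) \<otimes> inv g = g \<otimes> a \<otimes> inv g \<otimes> (g \<otimes> b \<otimes> inv g)"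
    if "a \<in> carrier G" "b \<in> carrier G" for a b
    using that assms by (simp add: m_assoc inv_solve_left)
  then have "(\<lambda>a. g \<otimes> a \<otimes> inv g) \<in> hom G G"
    using assms by (auto simp: hom_def)
  moreover have "continuous_map T T (\<lambda>a. g \<otimes> a \<otimes> inv g)"
    using assms by (intro continuous_map_mult) (auto simp: continuous_map_const)
  ultimately show ?thesis by (simp add: continuous_hom_def)
qed

text \<open>
  Conjugation is a continuous automorphism, so an invariant set of generators suffices.
\<close>

lemma closed_normal_csg:
  assumes S: "S \<subseteq> carrier G"
    and inv: "\<And>g s. g \<in> carrier G \<Longrightarrow> s \<in> S \<Longrightarrow> g \<otimes> s \<otimes> inv g \<in> csg S"
  shows "closed_normal (csg S)"
proof -
  note csg = closed_subgroup_csg[OF S]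
  have "g \<otimes> h \<otimes> inv g \<in> csg S" if g: "g \<in> carrier G" and h: "h \<in> csg S" for g h
  proof -
    have "closed_subgroup {a \<in> carrier G. g \<otimes> a \<otimes> inv g \<in> csg S}"
      using closed_subgroup_vimage[OF conjugation_continuous_hom[OF g]] csg is_group by blast
    moreover have "S \<subseteq> {a \<in> carrier G. g \<otimes> a \<otimes> inv g \<in> csg S}"
      using S g inv by auto
    ultimately show ?thesis
      using h csg_least by blast
  qed
  then show ?thesis
    using csg by (simp add: normal_inv_iff)
qed

text \<open>
  The product of two closed sets need not be closed in a topological group; here it is the
  continuous image of a compact set in a Hausdorff space.
\<close>

lemma closed_normal_set_mult:
  assumes "closed_normal M" "closed_normal N"
  shows "closed_normal (M <#> N)"
proof (rule conjI)
  show "(M <#> N) \<lhd> G"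
    using assms normal_subgroup_set_mult_closed by blast
  have "compactin (prod_topology T T) (M \<times> N)"
    using assms compact by (simp add: compactin_Times closedin_compact_space)
  moreover have "continuous_map (prod_topology T T) T (\<lambda>(a, b). a \<otimes> b)"
    using topological_group by (simp add: topological_group_def)
  ultimately have "compactin T ((\<lambda>(a, b). a \<otimes> b) ` (M \<times> N))"
    by (rule image_compactin)
  moreover have "(\<lambda>(a, b). a \<otimes> b) ` (M \<times> N) = M <#> N"
    by (auto simp: set_mult_def)
  ultimately show "closedin T (M <#> N)"
    using compactin_imp_closedin[OF Hausdorff] by simp
qed

lemma closed_normal_foldr_set_mult:
  assumes "\<And>N. N \<in> set Ns \<Longrightarrow> closed_normal N"
  shows "closed_normal (foldr (set_mult G) Ns {\<one>})"
  using assms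
proof (induction Ns)
  case Nil
  show ?case
    using one_is_normal Hausdorff by (simp add: closedin_Hausdorff_singleton)
next
  case (Cons N Ns)
  then show ?case
    using closed_normal_set_mult by simp
qed

lemma set_multI: "h \<in> H \<Longrightarrow> k \<in> K \<Longrightarrow> h \<otimes> k \<in> H <#> K"
  by (auto simp: set_mult_def)

lemma foldr_set_mult_subset:
  assumes "subgroup K G" "\<And>N. N \<in> set Ns \<Longrightarrow> N \<subseteq> K"
  shows "foldr (set_mult G) Ns {\<one>} \<subseteq> K"
  using assms(2)
proof (induction Ns)
  case Nil
  then show ?case using subgroup.one_closed[OF assms(1)] by simp
next
  case (Cons N Ns)
  then have "N <#> foldr (set_mult G) Ns {\<one>} \<subseteq> K <#> K"
    by (intro mono_set_mult) auto
  also have "\<dots> \<subseteq> K"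
    using subgroup.m_closed[OF assms(1)] by (auto simp: set_mult_def)
  finally show ?case by simp
qed

lemma subset_foldr_set_mult:
  assumes "\<And>N. N \<in> set Ns \<Longrightarrow> subgroup N G" "M \<in> set Ns"
  shows "M \<subseteq> foldr (set_mult G) Ns {\<one>}"
proof -
  have one: "\<one> \<in> foldr (set_mult G) Ns {\<one>}" if "\<And>N. N \<in> set Ns \<Longrightarrow> subgroup N G" for Ns
    using that
  proof (induction Ns)
    case (Cons N Ns)
    then have "\<one> \<otimes> \<one> \<in> N <#> foldr (set_mult G) Ns {\<one>}"
      by (intro set_multI) (auto simp: subgroup.one_closed)
    then show ?case by simp
  qed simp
  have "a \<in> foldr (set_mult G) Ns {\<one>}" if "a \<in> M" for a
    using assms
  proof (induction Ns)
    case (Cons N Ns)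
    have aG: "a \<in> carrier G"
      using that Cons.prems subgroup.mem_carrier by metis
    show ?case
    proof (cases "M = N")
      case True
      then have "a \<otimes> \<one> \<in> N <#> foldr (set_mult G) Ns {\<one>}"
        using that one[of Ns] Cons.prems(1) by (intro set_multI) auto
      then show ?thesis using aG by simp
    next
      case False
      then have "\<one> \<otimes> a \<in> N <#> foldr (set_mult G) Ns {\<one>}"
        using Cons by (intro set_multI) (auto simp: subgroup.one_closed)
      then show ?thesis using aG by simp
    qed
  qed simp
  then show ?thesis by blast
qed

end

section \<open>Commutators\<close>

context group
begin

abbreviation commutator :: "'a \<Rightarrow> 'a \<Rightarrow> 'a" where
  "commutator a b \<equiv> inv a \<otimes> inv b \<otimes> a \<otimes> b"

lemma l_inv_cancel:
  "a \<in> carrier G \<Longrightarrow> b \<in> carrier G \<Longrightarrow> inv a \<otimes> (a \<otimes> b) = b"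
  using m_assoc[of "inv a" a b] by simp

lemma commutator_eq_mult_inv:
  assumes "a \<in> carrier G" "b \<in> carrier G"
  shows "commutator a b = inv (b \<otimes> a) \<otimes> (a \<otimes> b)"
  using assms by (simp add: inv_mult_group m_assoc)

lemma commutator_eq_one_iff:
  assumes "a \<in> carrier G" "b \<in> carrier G"
  shows "commutator a b = \<one> \<longleftrightarrow> a \<otimes> b = b \<otimes> a"
  using assms by (metis commutator_eq_mult_inv inv_solve_left m_closed one_closed r_one)

lemma square_mult_commuting:
  assumes [simp]: "a \<in> carrier G" "c \<in> carrier G"
    and "c \<otimes> a = a \<otimes> c" "c \<otimes> c = \<one>"
  shows "(c \<otimes> a) \<otimes> (c \<otimes> a) = a \<otimes> a"
proof -
  have "(c \<otimes> a) \<otimes> (c \<otimes> a) = (a \<otimes> c) \<otimes> (c \<otimes> a)"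
    using assms(3) by simp
  also have "\<dots> = a \<otimes> (c \<otimes> c) \<otimes> a"
    by (simp add: m_assoc)
  finally show ?thesis
    using assms(4) by simp
qed

text \<open>
  This lemma and the one before it are used in a quotient by a term of the filtration: there the
  factors \<open>c\<close> and \<open>e\<close>, by which an automorphism changes \<open>a\<close> and \<open>b\<close>, lie so deep that the
  assumed commutation relations hold.
\<close>

lemma commutator_mult_commuting:
  assumes [simp]: "a \<in> carrier G" "b \<in> carrier G" "c \<in> carrier G" "e \<in> carrier G"
    and "c \<otimes> b = b \<otimes> c" "c \<otimes> e = e \<otimes> c" "a \<otimes> e = e \<otimes> a"
  shows "commutator (c \<otimes> a) (e \<otimes> b) = commutator a b"
proof -
  have "c \<otimes> a \<otimes> (e \<otimes> b) = c \<otimes> (a \<otimes> e) \<otimes> b"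
    by (simp add: m_assoc)
  also have "\<dots> = c \<otimes> (e \<otimes> a) \<otimes> b"
    using assms(7) by simp
  also have "\<dots> = c \<otimes> e \<otimes> (a \<otimes> b)"
    by (simp add: m_assoc)
  finally have 1: "c \<otimes> a \<otimes> (e \<otimes> b) = c \<otimes> e \<otimes> (a \<otimes> b)" .
  have "e \<otimes> b \<otimes> (c \<otimes> a) = e \<otimes> (b \<otimes> c) \<otimes> a"
    by (simp add: m_assoc)
  also have "\<dots> = e \<otimes> (c \<otimes> b) \<otimes> a"
    using assms(5) by simp
  also have "\<dots> = e \<otimes> c \<otimes> (b \<otimes> a)"
    by (simp add: m_assoc)
  finally have 2: "e \<otimes> b \<otimes> (c \<otimes> a) = c \<otimes> e \<otimes> (b \<otimes> a)"
    using assms(6) by simp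
  have "commutator (c \<otimes> a) (e \<otimes> b) = inv (c \<otimes> e \<otimes> (b \<otimes> a)) \<otimes> (c \<otimes> e \<otimes> (a \<otimes> b))"
    unfolding 1[symmetric] 2[symmetric] by (rule commutator_eq_mult_inv) simp_all
  also have "\<dots> = inv (b \<otimes> a) \<otimes> (inv (c \<otimes> e) \<otimes> ((c \<otimes> e) \<otimes> (a \<otimes> b)))"
    using inv_mult_group[of "c \<otimes> e" "b \<otimes> a"]
      m_assoc[of "inv (b \<otimes> a)" "inv (c \<otimes> e)" "c \<otimes> e \<otimes> (a \<otimes> b)"] by simp
  also have "inv (c \<otimes> e) \<otimes> ((c \<otimes> e) \<otimes> (a \<otimes> b)) = a \<otimes> b"
    by (rule l_inv_cancel) simp_all
  finally show ?thesis
    by (simp add: commutator_eq_mult_inv)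
qed

lemma commutator_closed [simp]:
  "a \<in> carrier G \<Longrightarrow> b \<in> carrier G \<Longrightarrow> commutator a b \<in> carrier G"
  by simp

lemma inv_commutator:
  assumes "a \<in> carrier G" "b \<in> carrier G"
  shows "inv (commutator a b) = commutator b a"
  using assms by (simp add: commutator_eq_mult_inv inv_mult_group)

end

lemma (in group_hom) hom_commutator:
  assumes "a \<in> carrier G" "b \<in> carrier G"
  shows "h (G.commutator a b) = H.commutator (h a) (h b)"
  using assms by simp

section \<open>The Zassenhaus filtration of a compact group\<close>

context compact_group
begin

abbreviation Z :: "nat \<Rightarrow> 'a set" where
  "Z n \<equiv> zassenhaus_filtration G T n"

definition zassenhaus_generators :: "nat \<Rightarrow> 'a set" where
  "zassenhaus_generators n = {a \<otimes> a | a. a \<in> Z ((n + 1) div 2)} \<union>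
     (\<Union>i\<in>{1..<n}. {commutator a b | a b. a \<in> Z i \<and> b \<in> Z (n - i)})"

lemma Z_le_1: "n \<le> 1 \<Longrightarrow> Z n = carrier G"
  by (simp add: zassenhaus_filtration.simps)

lemma group_hom_conjugation:
  assumes "g \<in> carrier G"
  shows "group_hom G G (\<lambda>a. g \<otimes> a \<otimes> inv g)"
  using conjugation_continuous_hom[OF assms] is_group
  by (simp add: continuous_hom_def group_hom_def group_hom_axioms_def)

lemma closed_normal_closed_squares:
  assumes "closed_normal A"
  shows "closed_normal (closed_squares G T A)"
proof -
  interpret A: normal A G using assms by simp
  show ?thesis
    unfolding closed_squares_def
  proof (rule closed_normal_csg)
    show "{a \<otimes> a |a. a \<in> A} \<subseteq> carrier G"
      using A.subset by auto
    fix g s assume g: "g \<in> carrier G" and "s \<in> {a \<otimes> a |a. a \<in> A}"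
    then obtain a where a: "a \<in> A" "s = a \<otimes> a" by auto
    interpret conj: group_hom G G "\<lambda>a. g \<otimes> a \<otimes> inv g"
      using g by (rule group_hom_conjugation)
    have "g \<otimes> s \<otimes> inv g = (g \<otimes> a \<otimes> inv g) \<otimes> (g \<otimes> a \<otimes> inv g)"
      using conj.hom_mult[of a a] a A.mem_carrier by simp
    then have "g \<otimes> s \<otimes> inv g \<in> {a \<otimes> a |a. a \<in> A}"
      using A.inv_op_closed2[OF g a(1)] by blast
    then show "g \<otimes> s \<otimes> inv g \<in> csg {a \<otimes> a |a. a \<in> A}"
      by (rule subsetD[OF csg_superset])
  qed
qed

lemma closed_normal_closed_commutators:
  assumes "closed_normal A" "closed_normal B"
  shows "closed_normal (closed_commutators G T A B)"
proof -
  interpret A: normal A G using assms by simp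
  interpret B: normal B G using assms by simp
  let ?S = "{commutator a b |a b. a \<in> A \<and> b \<in> B}"
  show ?thesis
    unfolding closed_commutators_def
  proof (rule closed_normal_csg)
    show "?S \<subseteq> carrier G"
      using A.mem_carrier B.mem_carrier by auto
    fix g s assume g: "g \<in> carrier G" and "s \<in> ?S"
    then obtain a b where ab: "a \<in> A" "b \<in> B" "s = commutator a b" by auto
    interpret conj: group_hom G G "\<lambda>a. g \<otimes> a \<otimes> inv g"
      using g by (rule group_hom_conjugation)
    have "g \<otimes> s \<otimes> inv g = commutator (g \<otimes> a \<otimes> inv g) (g \<otimes> b \<otimes> inv g)"
      using conj.hom_commutator[of a b] ab A.mem_carrier B.mem_carrier by simp
    then have "g \<otimes> s \<otimes> inv g \<in> ?S"
      using A.inv_op_closed2[OF g ab(1)] B.inv_op_closed2[OF g ab(2)] by blast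
    then show "g \<otimes> s \<otimes> inv g \<in> csg ?S"
      by (rule subsetD[OF csg_superset])
  qed
qed

text \<open>
  The filtration is defined by products of sets.  Once all earlier terms are closed and normal,
  the factors of the product are closed normal subgroups, so the product is a subgroup, is closed,
  and is generated by the squares and commutators that generate its factors.  Both claims go
  through one induction, since the second rests on the first for smaller indices.
\<close>

lemma closed_normal_Z_and_eq:
  "closed_normal (Z n) \<and> (2 \<le> n \<longrightarrow> Z n = csg (zassenhaus_generators n))"
proof (induction n rule: less_induct)
  case (less n)
  show ?case
  proof (cases "n \<le> 1")
    case True
    then show ?thesis
      using closed_subgroup_carrier by (simp add: Z_le_1 normal_inv_iff)
  next
    case False
    let ?Ns = "closed_squares G T (Z ((n + 1) div 2)) #
      map (\<lambda>i. closed_commutators G T (Z i) (Z (n - i))) [1..<n]"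
    have Z: "Z n = foldr (set_mult G) ?Ns {\<one>}"
      using False by (subst zassenhaus_filtration.simps) simp
    have cn: "closed_normal N" if "N \<in> set ?Ns" for N
    proof -
      have "closed_normal (closed_squares G T (Z ((n + 1) div 2)))"
        using False by (intro closed_normal_closed_squares less.IH[THEN conjunct1]) linarith
      moreover have "closed_normal (closed_commutators G T (Z i) (Z (n - i)))"
        if "i \<in> {1..<n}" for i
        using that by (intro closed_normal_closed_commutators less.IH[THEN conjunct1]) auto
      ultimately show ?thesis
        using that by auto
    qed
    then have "closed_normal (Z n)"
      unfolding Z by (rule closed_normal_foldr_set_mult)
    moreover have "Z n \<subseteq> csg (zassenhaus_generators n)"
    proof -
      have "zassenhaus_generators n \<subseteq> carrier G"
      proof -
        have "Z i \<subseteq> carrier G" if "i < n" for i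
          using less.IH[OF that] normal_imp_subgroup subgroup.subset by blast
        then have "Z ((n + 1) div 2) \<subseteq> carrier G"
          "\<And>i. i \<in> {1..<n} \<Longrightarrow> Z i \<subseteq> carrier G \<and> Z (n - i) \<subseteq> carrier G"
          using False by auto
        then show ?thesis
          unfolding zassenhaus_generators_def by fastforce
      qed
      moreover have "N \<subseteq> csg (zassenhaus_generators n)" if "N \<in> set ?Ns" for N
      proof -
        from that consider "N = closed_squares G T (Z ((n + 1) div 2))"
          | i where "i \<in> {1..<n}" "N = closed_commutators G T (Z i) (Z (n - i))"
          by auto
        then show ?thesis
        proof cases
          case 1
          then show ?thesis
            unfolding closed_squares_def zassenhaus_generators_def by (simp add: csg_mono)
        next
          case 2
          have "{commutator a b |a b. a \<in> Z i \<and> b \<in> Z (n - i)} \<subseteq> zassenhaus_generators n"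
            unfolding zassenhaus_generators_def using 2(1) by blast
          then show ?thesis
            unfolding 2(2) closed_commutators_def by (rule csg_mono)
        qed
      qed
      ultimately show ?thesis
        unfolding Z using closed_subgroup_csg by (intro foldr_set_mult_subset) auto
    qed
    moreover have "csg (zassenhaus_generators n) \<subseteq> Z n"
    proof (rule csg_least)
      have N: "N \<subseteq> Z n" if "N \<in> set ?Ns" for N
        unfolding Z using cn normal_imp_subgroup by (intro subset_foldr_set_mult that) blast
      have "{a \<otimes> a |a. a \<in> Z ((n + 1) div 2)} \<subseteq> Z n"
        using order_trans[OF csg_superset N[of "closed_squares G T (Z ((n + 1) div 2))",
              unfolded closed_squares_def]]
        by (simp add: closed_squares_def)
      moreover have "{commutator a b |a b. a \<in> Z i \<and> b \<in> Z (n - i)} \<subseteq> Z n"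
        if "i \<in> {1..<n}" for i
        using order_trans[OF csg_superset N[of "closed_commutators G T (Z i) (Z (n - i))",
              unfolded closed_commutators_def]] that
        by (simp add: closed_commutators_def)
      ultimately show "zassenhaus_generators n \<subseteq> Z n"
        unfolding zassenhaus_generators_def by blast
      show "closed_subgroup (Z n)"
        using \<open>closed_normal (Z n)\<close> normal_imp_subgroup by blast
    qed
    ultimately show ?thesis by blast
  qed
qed

lemma closed_normal_Z: "closed_normal (Z n)"
  using closed_normal_Z_and_eq by blast

lemma Z_eq_csg: "2 \<le> n \<Longrightarrow> Z n = csg (zassenhaus_generators n)"
  using closed_normal_Z_and_eq by blast

lemma closed_subgroup_Z: "closed_subgroup (Z n)"
  using closed_normal_Z normal_imp_subgroup by blast

lemma Z_subset: "Z n \<subseteq> carrier G"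
  using closed_subgroup_Z subgroup.subset by blast

text \<open>
  Every upper bound on a term of the filtration is obtained from this minimality.
\<close>

lemma Z_least:
  assumes "2 \<le> n" "closed_subgroup K"
    and "\<And>a. a \<in> Z ((n + 1) div 2) \<Longrightarrow> a \<otimes> a \<in> K"
    and "\<And>i j a b. 1 \<le> i \<Longrightarrow> 1 \<le> j \<Longrightarrow> i + j = n \<Longrightarrow> a \<in> Z i \<Longrightarrow> b \<in> Z j \<Longrightarrow> commutator a b \<in> K"
  shows "Z n \<subseteq> K"
proof -
  have "commutator a b \<in> K" if "i \<in> {1..<n}" "a \<in> Z i" "b \<in> Z (n - i)" for i a b
    using that by (intro assms(4)[of i "n - i"]) auto
  then have "zassenhaus_generators n \<subseteq> K"
    unfolding zassenhaus_generators_def using assms(3) by blast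
  then show ?thesis
    unfolding Z_eq_csg[OF assms(1)] using assms(2) by (rule csg_least)
qed

lemma square_mem_Z:
  assumes "2 \<le> n" "a \<in> Z ((n + 1) div 2)"
  shows "a \<otimes> a \<in> Z n"
  unfolding Z_eq_csg[OF assms(1)]
  using assms csg_superset[of "zassenhaus_generators n"] unfolding zassenhaus_generators_def by blast

lemma commutator_mem_Z:
  assumes "1 \<le> i" "1 \<le> j" "a \<in> Z i" "b \<in> Z j"
  shows "commutator a b \<in> Z (i + j)"
proof -
  have "commutator a b \<in> {commutator a b | a b. a \<in> Z i \<and> b \<in> Z (i + j - i)}"
    using assms by auto
  moreover have "i \<in> {1..<i + j}" using assms by simp
  ultimately have "commutator a b \<in> zassenhaus_generators (i + j)"
    unfolding zassenhaus_generators_def by blast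
  moreover have "2 \<le> i + j" using assms by simp
  ultimately show ?thesis
    using csg_superset by (auto simp: Z_eq_csg)
qed

text \<open>
  A commutator of elements of levels \<open>i\<close> and \<open>j\<close> with \<open>i + j = n + 1\<close> lies in level \<open>n\<close>
  because one of the two levels can be lowered by one, by the induction hypothesis.
\<close>

lemma Z_Suc_subset: "Z (Suc n) \<subseteq> Z n"
proof (induction n rule: less_induct)
  case (less n)
  show ?case
  proof (cases "n \<le> 1")
    case True
    then show ?thesis using Z_subset by (simp add: Z_le_1)
  next
    case False
    then have n: "2 \<le> n" by simp
    show ?thesis
    proof (rule Z_least[OF _ closed_subgroup_Z])
      fix a assume a: "a \<in> Z ((Suc n + 1) div 2)"
      have "(Suc n + 1) div 2 = (n + 1) div 2 \<or>
        (Suc n + 1) div 2 = Suc ((n + 1) div 2) \<and> (n + 1) div 2 < n"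
        using n by presburger
      then have "a \<in> Z ((n + 1) div 2)"
        using a less.IH by (metis subsetD)
      then show "a \<otimes> a \<in> Z n" by (rule square_mem_Z[OF n])
    next
      fix i j a b assume ij: "1 \<le> i" "1 \<le> j" "i + j = Suc n" and ab: "a \<in> Z i" "b \<in> Z j"
      show "commutator a b \<in> Z n"
      proof (cases "i = 1")
        case True
        then obtain k where "j = Suc k" "k < n" "1 \<le> k" "i + k = n"
          using ij n by (cases j) auto
        then show ?thesis
          using commutator_mem_Z[of i k a b] less.IH[of k] ab ij by auto
      next
        case False
        then obtain k where "i = Suc k" "1 \<le> k" "k + j = n" "k < n"
          using ij by (cases i) auto
        then show ?thesis
          using commutator_mem_Z[of k j a b] less.IH[of k] ab ij by auto
      qed
    qed (use n in simp)
  qed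
qed

lemma Z_antimono: "m \<le> n \<Longrightarrow> Z n \<subseteq> Z m"
  using Z_Suc_subset by (rule lift_Suc_antimono_le)

text \<open>
  Homomorphisms carry squares to squares and commutators to commutators.
\<close>

lemma Z_functorial:
  assumes f: "f \<in> continuous_hom G T K S" and "compact_group K S"
  shows "a \<in> Z n \<Longrightarrow> f a \<in> zassenhaus_filtration K S n"
proof (induction n arbitrary: a rule: less_induct)
  case (less n)
  interpret K: compact_group K S by fact
  interpret f: group_hom G K f
    using f is_group K.is_group by (simp add: continuous_hom_def group_hom_def group_hom_axioms_def)
  show ?case
  proof (cases "n \<le> 1")
    case True
    then show ?thesis using less.prems by (simp add: Z_le_1 K.Z_le_1)
  next
    case False
    then have n: "2 \<le> n" by simp
    have "Z n \<subseteq> {a \<in> carrier G. f a \<in> K.Z n}"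
    proof (rule Z_least[OF n])
      show "closed_subgroup {a \<in> carrier G. f a \<in> K.Z n}"
        using closed_subgroup_vimage[OF f K.is_group] K.closed_subgroup_Z by blast
    next
      fix a assume a: "a \<in> Z ((n + 1) div 2)"
      then have aG: "a \<in> carrier G" using Z_subset by blast
      have "f a \<in> K.Z ((n + 1) div 2)"
        using n a by (intro less.IH) linarith
      then have "f (a \<otimes> a) \<in> K.Z n"
        using K.square_mem_Z[OF n] aG by simp
      then show "a \<otimes> a \<in> {a \<in> carrier G. f a \<in> K.Z n}"
        using aG by simp
    next
      fix i j a b assume ij: "1 \<le> i" "1 \<le> j" "i + j = n" and ab: "a \<in> Z i" "b \<in> Z j"
      then have G: "a \<in> carrier G" "b \<in> carrier G" using Z_subset by blast+
      have "f a \<in> K.Z i" "f b \<in> K.Z j"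
        using less.IH ab ij by auto
      then have "f (commutator a b) \<in> K.Z n"
        using K.commutator_mem_Z[of i j] ij G by auto
      then show "commutator a b \<in> {a \<in> carrier G. f a \<in> K.Z n}"
        using G by simp
    qed
    then show ?thesis using less.prems by blast
  qed
qed

section \<open>Automorphisms that act trivially on the factors of the filtration\<close>

text \<open>
  The elements that \<open>\<sigma>\<close> fixes modulo \<open>N\<close> are those at which \<open>\<sigma>\<close> and the identity agree after
  passing to the quotient, whence the subgroup; \<open>a \<mapsto> \<sigma> a \<otimes> inv a\<close> is continuous, whence
  closedness.
\<close>

lemma closed_subgroup_fixed_mod:
  assumes \<sigma>: "\<sigma> \<in> continuous_hom G T G T" and N: "closed_normal N"
  shows "closed_subgroup {a \<in> carrier G. \<sigma> a \<otimes> inv a \<in> N}"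
proof -
  interpret N: normal N G using N by simp
  interpret \<sigma>: group_hom G G \<sigma>
    using \<sigma> is_group by (simp add: continuous_hom_def group_hom_def group_hom_axioms_def)
  have "continuous_map T T (\<lambda>a. \<sigma> a \<otimes> inv a)"
    using \<sigma> by (intro continuous_map_mult continuous_map_inv) (auto simp: continuous_hom_def)
  then have "closedin T {a \<in> carrier G. \<sigma> a \<otimes> inv a \<in> N}"
    using closedin_continuous_map_preimage[of T T _ N] N by simp
  moreover have "subgroup {a \<in> carrier G. \<sigma> a \<otimes> inv a \<in> N} G"
  proof (rule subgroupI)
    have "\<one> \<in> {a \<in> carrier G. \<sigma> a \<otimes> inv a \<in> N}" by simp
    then show "{a \<in> carrier G. \<sigma> a \<otimes> inv a \<in> N} \<noteq> {}" by blast
  next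
    fix a assume "a \<in> {a \<in> carrier G. \<sigma> a \<otimes> inv a \<in> N}"
    then have a: "a \<in> carrier G" "\<sigma> a \<otimes> inv a \<in> N" by auto
    have "inv a \<otimes> inv (\<sigma> a \<otimes> inv a) \<otimes> a \<in> N"
      using N.inv_op_closed1[OF a(1) N.m_inv_closed[OF a(2)]] .
    also have "inv a \<otimes> inv (\<sigma> a \<otimes> inv a) \<otimes> a = \<sigma> (inv a) \<otimes> inv (inv a)"
      using a(1) by (simp add: inv_mult_group m_assoc[symmetric])
    finally show "inv a \<in> {a \<in> carrier G. \<sigma> a \<otimes> inv a \<in> N}"
      using a by simp
  next
    fix a b assume "a \<in> {a \<in> carrier G. \<sigma> a \<otimes> inv a \<in> N}" "b \<in> {a \<in> carrier G. \<sigma> a \<otimes> inv a \<in> N}"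
    then have a: "a \<in> carrier G" "\<sigma> a \<otimes> inv a \<in> N" and b: "b \<in> carrier G" "\<sigma> b \<otimes> inv b \<in> N"
      by auto
    have "\<sigma> a \<otimes> inv a \<otimes> (a \<otimes> (\<sigma> b \<otimes> inv b) \<otimes> inv a) \<in> N"
      using N.m_closed[OF a(2) N.inv_op_closed2[OF a(1) b(2)]] .
    also have "\<sigma> a \<otimes> inv a \<otimes> (a \<otimes> (\<sigma> b \<otimes> inv b) \<otimes> inv a)
      = \<sigma> (a \<otimes> b) \<otimes> inv (a \<otimes> b)"
      using a(1) b(1) by (simp add: inv_mult_group m_assoc l_inv_cancel)
    finally show "a \<otimes> b \<in> {a \<in> carrier G. \<sigma> a \<otimes> inv a \<in> N}"
      using a b by simp
  qed auto
  ultimately show ?thesis by blast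
qed

text \<open>
  The direct sum of the factors is generated from its first summand by commutators and squares,
  that is, as a restricted Lie algebra, so an endomorphism that is trivial on the first factor is
  trivial on all of them.  Concretely, let \<open>\<sigma> a = c \<otimes> a\<close> and \<open>\<sigma> b = e \<otimes> b\<close>, where by induction
  \<open>c\<close> and \<open>e\<close> lie one level deeper than \<open>a\<close> and \<open>b\<close>.  Modulo level \<open>n + 1\<close> this makes
  \<open>c\<close> commute with \<open>b\<close> and \<open>e\<close>, and \<open>e\<close> with \<open>a\<close>, so that the commutator of \<open>a\<close> and \<open>b\<close>
  is fixed.  For a square \<open>a \<otimes> a\<close>, the correction \<open>c\<close> commutes with \<open>a\<close>, and \<open>c \<otimes> c\<close> vanishes.
\<close>

lemma trivial_action_on_factors:
  assumes \<sigma>: "\<sigma> \<in> continuous_hom G T G T"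
    and triv: "\<And>a. a \<in> carrier G \<Longrightarrow> \<sigma> a \<otimes> inv a \<in> Z 2"
  shows "1 \<le> n \<Longrightarrow> a \<in> Z n \<Longrightarrow> \<sigma> a \<otimes> inv a \<in> Z (Suc n)"
proof (induction n arbitrary: a rule: less_induct)
  case (less n)
  interpret \<sigma>: group_hom G G \<sigma>
    using \<sigma> is_group by (simp add: continuous_hom_def group_hom_def group_hom_axioms_def)
  show ?case
  proof (cases "n = 1")
    case True
    then show ?thesis using triv[of a] less.prems Z_subset by (auto simp: numeral_2_eq_2)
  next
    case False
    then have n: "2 \<le> n" using less.prems by simp
    let ?N = "Z (Suc n)"
    interpret N: normal ?N G using closed_normal_Z by simp
    let ?Q = "G Mod ?N"
    let ?q = "\<lambda>a. ?N #> a"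
    interpret q: group_hom G ?Q ?q
      using N.r_coset_hom_Mod N.factorgroup_is_group is_group
      by (simp add: group_hom_def group_hom_axioms_def)
    have q_one: "?q a = \<one>\<^bsub>?Q\<^esub> \<longleftrightarrow> a \<in> ?N" if "a \<in> carrier G" for a
      using that coset_join1[of ?N a] coset_join2[of a ?N] N.subgroup_axioms by auto
    have q_eq: "\<sigma> a \<otimes> inv a \<in> ?N" if "a \<in> carrier G" "?q (\<sigma> a) = ?q a" for a
    proof -
      have "?q (\<sigma> a \<otimes> inv a) = \<one>\<^bsub>?Q\<^esub>"
        using that q.hom_mult[of "\<sigma> a" "inv a"] q.hom_inv q.H.r_inv q.hom_closed
        by (simp del: mult_FactGroup one_FactGroup)
      then show ?thesis
        using q_one[of "\<sigma> a \<otimes> inv a"] that(1) \<sigma>.hom_closed inv_closed m_closed by metis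
    qed
    have q_comm: "?q a \<otimes>\<^bsub>?Q\<^esub> ?q b = ?q b \<otimes>\<^bsub>?Q\<^esub> ?q a"
      if "1 \<le> i" "1 \<le> j" "n < i + j" "a \<in> Z i" "b \<in> Z j" for a b i j
    proof -
      have ab: "a \<in> carrier G" "b \<in> carrier G" using that Z_subset by blast+
      have "commutator a b \<in> ?N"
        using commutator_mem_Z[of i j a b] that Z_antimono[of "Suc n" "i + j"] by auto
      then have "q.H.commutator (?q a) (?q b) = \<one>\<^bsub>?Q\<^esub>"
        using q_one[of "commutator a b"] q.hom_commutator ab by simp
      then show ?thesis
        using q.H.commutator_eq_one_iff ab q.hom_closed by blast
    qed
    have \<sigma>_eq: "\<exists>c \<in> Z (Suc m). \<sigma> a = c \<otimes> a" if "1 \<le> m" "m < n" "a \<in> Z m" for m a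
    proof
      show "\<sigma> a \<otimes> inv a \<in> Z (Suc m)" using less.IH that by blast
      show "\<sigma> a = \<sigma> a \<otimes> inv a \<otimes> a"
        using that Z_subset[of m] by (auto simp: m_assoc)
    qed
    have "Z n \<subseteq> {a \<in> carrier G. \<sigma> a \<otimes> inv a \<in> ?N}"
    proof (rule Z_least[OF n])
      show "closed_subgroup {a \<in> carrier G. \<sigma> a \<otimes> inv a \<in> ?N}"
        using closed_subgroup_fixed_mod[OF \<sigma>] closed_normal_Z by blast
    next
      fix a assume a: "a \<in> Z ((n + 1) div 2)"
      let ?m = "(n + 1) div 2"
      have m: "1 \<le> ?m" "?m < n" using n by auto
      from \<sigma>_eq[OF m a] obtain c where c: "c \<in> Z (Suc ?m)" "\<sigma> a = c \<otimes> a" by blast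
      have G [simp]: "a \<in> carrier G" "c \<in> carrier G"
        using a c Z_subset by blast+
      have "c \<otimes> c \<in> Z (2 * Suc ?m)"
        using c by (intro square_mem_Z) auto
      moreover have "Suc n \<le> 2 * Suc ?m"
        by presburger
      ultimately have "c \<otimes> c \<in> ?N"
        using Z_antimono by blast
      then have cc: "?q c \<otimes>\<^bsub>?Q\<^esub> ?q c = \<one>\<^bsub>?Q\<^esub>"
        using q_one[of "c \<otimes> c"] by simp
      have "?q c \<otimes>\<^bsub>?Q\<^esub> ?q a = ?q a \<otimes>\<^bsub>?Q\<^esub> ?q c"
        using a c m by (intro q_comm[of "Suc ?m" ?m]) auto
      then have "(?q c \<otimes>\<^bsub>?Q\<^esub> ?q a) \<otimes>\<^bsub>?Q\<^esub> (?q c \<otimes>\<^bsub>?Q\<^esub> ?q a) = ?q a \<otimes>\<^bsub>?Q\<^esub> ?q a"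
        using cc by (intro q.H.square_mult_commuting q.hom_closed G)
      then have "?q (\<sigma> (a \<otimes> a)) = ?q (a \<otimes> a)"
        using q.hom_mult[of "c \<otimes> a" "c \<otimes> a"] q.hom_mult[of c a] q.hom_mult[of a a] c(2)
        by simp
      then show "a \<otimes> a \<in> {a \<in> carrier G. \<sigma> a \<otimes> inv a \<in> ?N}"
        using q_eq[of "a \<otimes> a"] m_closed[OF G(1) G(1)] by blast
    next
      fix i j a b assume ij: "1 \<le> i" "1 \<le> j" "i + j = n" and ab: "a \<in> Z i" "b \<in> Z j"
      from \<sigma>_eq[OF ij(1) _ ab(1)] ij obtain c where c: "c \<in> Z (Suc i)" "\<sigma> a = c \<otimes> a" by auto
      from \<sigma>_eq[OF ij(2) _ ab(2)] ij obtain e where e: "e \<in> Z (Suc j)" "\<sigma> b = e \<otimes> b" by auto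
      have G [simp]: "a \<in> carrier G" "b \<in> carrier G" "c \<in> carrier G" "e \<in> carrier G"
        using ab c e Z_subset by blast+
      have "?q c \<otimes>\<^bsub>?Q\<^esub> ?q b = ?q b \<otimes>\<^bsub>?Q\<^esub> ?q c"
        using q_comm[of "Suc i" j] ij ab c by auto
      moreover have "?q c \<otimes>\<^bsub>?Q\<^esub> ?q e = ?q e \<otimes>\<^bsub>?Q\<^esub> ?q c"
        using q_comm[of "Suc i" "Suc j"] ij e c by auto
      moreover have "?q a \<otimes>\<^bsub>?Q\<^esub> ?q e = ?q e \<otimes>\<^bsub>?Q\<^esub> ?q a"
        using q_comm[of i "Suc j"] ij ab e by auto
      ultimately have "q.H.commutator (?q (\<sigma> a)) (?q (\<sigma> b)) = q.H.commutator (?q a) (?q b)"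
        unfolding c(2) e(2) q.hom_mult[OF G(3) G(1)] q.hom_mult[OF G(4) G(2)]
        by (intro q.H.commutator_mult_commuting q.hom_closed G)
      then have "?q (\<sigma> (commutator a b)) = ?q (commutator a b)"
        using q.hom_commutator[of "\<sigma> a" "\<sigma> b"] q.hom_commutator[of a b] \<sigma>.hom_commutator[of a b]
        by (metis G(1) G(2) \<sigma>.hom_closed)
      then show "commutator a b \<in> {a \<in> carrier G. \<sigma> a \<otimes> inv a \<in> ?N}"
        using q_eq[of "commutator a b"] commutator_closed[OF G(1) G(2)] by blast
    qed
    then show ?thesis using less.prems by blast
  qed
qed

end

section \<open>Open normal subgroups of profinite groups\<close>

text \<open>
  In a compact Hausdorff space components are quasi-components, so total disconnectedness yields a
  clopen set \<open>U\<close> that contains the identity and misses \<open>C\<close>.  The elements \<open>u\<close> that can be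
  inserted at or deleted from any place of a product without affecting its membership in \<open>U\<close>
  form a normal subgroup \<open>N\<close> inside \<open>U\<close>.  It is open because its complement is the projection
  of a closed set along a compact factor.
\<close>

lemma (in compact_group) open_normal_subgroup_disjoint:
  assumes td: "\<forall>S. connectedin T S \<longrightarrow> (\<exists>a. S \<subseteq> {a})"
    and C: "closedin T C" "\<one> \<notin> C"
  shows "\<exists>N. N \<lhd> G \<and> openin T N \<and> N \<inter> C = {}"
proof -
  have "connected_component_of_set T \<one> = {\<one>}"
  proof -
    obtain a where "connected_component_of_set T \<one> \<subseteq> {a}"
      using td[rule_format, OF connectedin_connected_component_of] by metis
    moreover have "\<one> \<in> connected_component_of_set T \<one>"
      by (simp add: connected_component_of_refl)
    ultimately show ?thesis by blast
  qed
  then have "{\<one>} \<in> quasi_components_of T"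
    using quasi_eq_connected_components_of[of T] compact Hausdorff
    by (auto simp: connected_components_of_def image_iff intro!: bexI[of _ "\<one>"])
  then have "separated_between T {\<one>} C"
    using C compact by (simp add: separated_between_quasi_component_compact closedin_compact_space)
  then obtain U V where U: "openin T U" "openin T V" "U \<union> V = carrier G" "disjnt U V" "\<one> \<in> U" "C \<subseteq> V"
    unfolding separated_between_def by auto
  then have V: "V = carrier G - U"
    by (auto simp: disjnt_def)
  have clopen: "closedin T U" "closedin T V"
    using U(1,2) openin_subset[OF U(1)] by (simp_all add: V closedin_def double_diff)
  define N where "N = {u \<in> carrier G. \<forall>a\<in>carrier G. \<forall>b\<in>carrier G. a \<otimes> u \<otimes> b \<in> U \<longleftrightarrow> a \<otimes> b \<in> U}"
  define TT where "TT = prod_topology T (prod_topology T T)"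
  define f where "f = (\<lambda>(u, a, b). a \<otimes> u \<otimes> b)"
  define g where "g = (\<lambda>(u :: 'a, a, b). a \<otimes> b)"
  have pr: "continuous_map TT T fst" "continuous_map TT T (fst \<circ> snd)" "continuous_map TT T (snd \<circ> snd)"
    unfolding TT_def
    by (rule continuous_map_fst continuous_map_snd continuous_map_compose)+
  have fg: "continuous_map TT T f" "continuous_map TT T g"
    using continuous_map_mult[OF continuous_map_mult[OF pr(2,1)] pr(3)] continuous_map_mult[OF pr(2,3)]
    by (simp_all add: f_def g_def case_prod_unfold)
  \<comment> \<open>the triples \<open>(u, a, b)\<close> that witness \<open>u \<notin> N\<close>\<close>
  define D where "D = {p \<in> topspace TT. f p \<in> U} \<inter> {p \<in> topspace TT. g p \<in> V}
    \<union> {p \<in> topspace TT. f p \<in> V} \<inter> {p \<in> topspace TT. g p \<in> U}"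
  have "closedin TT D"
    unfolding D_def
    by (intro closedin_Un closedin_Int closedin_continuous_map_preimage[OF fg(1)]
        closedin_continuous_map_preimage[OF fg(2)] clopen)
  then have "closedin T (fst ` D)"
    using closed_map_fst[of "prod_topology T T" T] compact
    by (simp add: TT_def closed_map_def compact_space_prod_topology)
  moreover have "N = topspace T - fst ` D"
  proof -
    have "(u, a, b) \<in> D \<longleftrightarrow> u \<in> carrier G \<and> a \<in> carrier G \<and> b \<in> carrier G \<and>
        \<not> (a \<otimes> u \<otimes> b \<in> U \<longleftrightarrow> a \<otimes> b \<in> U)" for u a b
      by (auto simp: D_def TT_def f_def g_def V)
    moreover have "u \<in> fst ` D \<longleftrightarrow> (\<exists>a b. (u, a, b) \<in> D)" for u
      by force
    ultimately show ?thesis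
      by (auto simp: N_def)
  qed
  ultimately have "openin T N"
    by blast
  moreover have "N \<lhd> G"
  proof (rule normal_invI)
    show "subgroup N G"
    proof (rule subgroupI)
      show "N \<subseteq> carrier G" by (auto simp: N_def)
      have "\<one> \<in> N" by (simp add: N_def)
      then show "N \<noteq> {}" by blast
    next
      fix u assume u: "u \<in> N"
      then have uG [simp]: "u \<in> carrier G" by (simp add: N_def)
      have "a \<otimes> inv u \<otimes> b \<in> U \<longleftrightarrow> a \<otimes> b \<in> U" if [simp]: "a \<in> carrier G" "b \<in> carrier G" for a b
      proof -
        have "a \<otimes> inv u \<otimes> u \<otimes> b \<in> U \<longleftrightarrow> a \<otimes> inv u \<otimes> b \<in> U"
          using u by (simp add: N_def)
        moreover have "a \<otimes> inv u \<otimes> u \<otimes> b = a \<otimes> b"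
          by (simp add: m_assoc l_inv_cancel)
        ultimately show ?thesis by simp
      qed
      then show "inv u \<in> N" by (simp add: N_def)
    next
      fix u v assume uv: "u \<in> N" "v \<in> N"
      then have uG [simp]: "u \<in> carrier G" "v \<in> carrier G" by (simp_all add: N_def)
      have "a \<otimes> (u \<otimes> v) \<otimes> b \<in> U \<longleftrightarrow> a \<otimes> b \<in> U" if [simp]: "a \<in> carrier G" "b \<in> carrier G" for a b
      proof -
        have "a \<otimes> u \<otimes> (v \<otimes> b) \<in> U \<longleftrightarrow> a \<otimes> (v \<otimes> b) \<in> U" "a \<otimes> v \<otimes> b \<in> U \<longleftrightarrow> a \<otimes> b \<in> U"
          using uv by (simp_all add: N_def)
        then show ?thesis by (simp add: m_assoc)
      qed
      then show "u \<otimes> v \<in> N" by (simp add: N_def)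
    qed
    fix x u assume [simp]: "x \<in> carrier G" and u: "u \<in> N"
    then have uG [simp]: "u \<in> carrier G" by (simp add: N_def)
    have "a \<otimes> (x \<otimes> u \<otimes> inv x) \<otimes> b \<in> U \<longleftrightarrow> a \<otimes> b \<in> U"
      if [simp]: "a \<in> carrier G" "b \<in> carrier G" for a b
    proof -
      have "a \<otimes> x \<otimes> u \<otimes> (inv x \<otimes> b) \<in> U \<longleftrightarrow> a \<otimes> x \<otimes> (inv x \<otimes> b) \<in> U"
        using u by (simp add: N_def)
      moreover have "x \<otimes> (inv x \<otimes> b) = b"
        using m_assoc[of x "inv x" b] by simp
      ultimately show ?thesis by (simp add: m_assoc)
    qed
    then show "x \<otimes> u \<otimes> inv x \<in> N" by (simp add: N_def)
  qed
  moreover have "N \<inter> C = {}"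
  proof -
    have "u \<in> U" if "u \<in> N" for u
    proof -
      have "\<one> \<otimes> u \<otimes> \<one> \<in> U \<longleftrightarrow> \<one> \<otimes> \<one> \<in> U" "u \<in> carrier G"
        using that unfolding N_def by blast+
      then show ?thesis using U(5) by simp
    qed
    then show ?thesis using U(4,6) by (auto simp: disjnt_def)
  qed
  ultimately show ?thesis by blast
qed

section \<open>Separating a subgroup of a finite 2-group by homomorphisms\<close>

lemma finite_carrier_if_order_power:
  "order R = 2 ^ k \<Longrightarrow> finite (carrier R)"
  by (metis card_ge_0_finite order_def pos2 zero_less_power)

text \<open>
  This is the regular wreath product \<open>C\<^sub>2 \<wr> Q\<close>.  Subsets of \<open>Q\<close> under symmetric difference stand for
  functions from \<open>Q\<close> to \<open>C\<^sub>2\<close>, and the set in the product below is the symmetric difference of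
  \<open>A\<close> and the translate of \<open>B\<close> by \<open>g\<close>, written by membership so that the group laws become
  propositional.
\<close>

definition subset_wreath :: "('a, 'm) monoid_scheme \<Rightarrow> ('a set \<times> 'a) monoid" where
  "subset_wreath Q =
    \<lparr>carrier = Pow (carrier Q) \<times> carrier Q,
     monoid.mult = (\<lambda>(A, g) (B, h).
       ({x \<in> carrier Q. (x \<in> A) \<noteq> (inv\<^bsub>Q\<^esub> g \<otimes>\<^bsub>Q\<^esub> x \<in> B)}, g \<otimes>\<^bsub>Q\<^esub> h)),
     one = ({}, \<one>\<^bsub>Q\<^esub>)\<rparr>"

context group
begin

lemma group_subset_wreath: "group (subset_wreath G)"
proof (rule groupI)
  fix p q r assume "p \<in> carrier (subset_wreath G)" "q \<in> carrier (subset_wreath G)"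
    "r \<in> carrier (subset_wreath G)"
  then obtain A a B b C c where [simp]: "p = (A, a)" "q = (B, b)" "r = (C, c)"
      "a \<in> carrier G" "b \<in> carrier G" "c \<in> carrier G"
    and "A \<subseteq> carrier G" "B \<subseteq> carrier G" "C \<subseteq> carrier G"
    by (auto simp: subset_wreath_def)
  have "inv (a \<otimes> b) \<otimes> x = inv b \<otimes> (inv a \<otimes> x)" if "x \<in> carrier G" for x
    using that by (simp add: inv_mult_group m_assoc)
  then show "p \<otimes>\<^bsub>subset_wreath G\<^esub> q \<otimes>\<^bsub>subset_wreath G\<^esub> r =
      p \<otimes>\<^bsub>subset_wreath G\<^esub> (q \<otimes>\<^bsub>subset_wreath G\<^esub> r)"
    by (auto simp: subset_wreath_def m_assoc)
next
  fix p assume "p \<in> carrier (subset_wreath G)"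
  then obtain A a where [simp]: "p = (A, a)" "a \<in> carrier G" and A: "A \<subseteq> carrier G"
    by (auto simp: subset_wreath_def)
  let ?q = "({x \<in> carrier G. a \<otimes> x \<in> A}, inv a)"
  have "?q \<in> carrier (subset_wreath G)" "?q \<otimes>\<^bsub>subset_wreath G\<^esub> p = \<one>\<^bsub>subset_wreath G\<^esub>"
    by (auto simp: subset_wreath_def)
  then show "\<exists>q\<in>carrier (subset_wreath G). q \<otimes>\<^bsub>subset_wreath G\<^esub> p = \<one>\<^bsub>subset_wreath G\<^esub>"
    by blast
qed (auto simp: subset_wreath_def)

lemma order_subset_wreath:
  assumes "order G = 2 ^ k"
  shows "order (subset_wreath G) = 2 ^ (2 ^ k + k)"
proof -
  have "finite (carrier G)"
    using assms by (rule finite_carrier_if_order_power)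
  then show ?thesis
    using assms by (simp add: order_def subset_wreath_def card_cartesian_product card_Pow power_add)
qed

text \<open>
  The homomorphism is the standard embedding \<open>g \<mapsto> ({}, g)\<close> followed by conjugation with
  \<open>(L, \<one>)\<close>.
\<close>

lemma subset_wreath_embedding:
  assumes L: "L \<subseteq> carrier G"
  shows "(\<lambda>g. ({x \<in> carrier G. (x \<in> L) \<noteq> (inv g \<otimes> x \<in> L)}, g)) \<in> hom G (subset_wreath G)"
proof -
  have "inv (a \<otimes> b) \<otimes> x = inv b \<otimes> (inv a \<otimes> x)"
    if "x \<in> carrier G" "a \<in> carrier G" "b \<in> carrier G" for x a b
    using that by (simp add: inv_mult_group m_assoc)
  then show ?thesis
    by (auto simp: hom_def subset_wreath_def)
qed

text \<open>
  The standard embedding of \<open>G\<close> into the wreath product and its conjugate by \<open>(L, \<one>)\<close> agree at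
  \<open>a\<close> exactly if \<open>(L, \<one>)\<close> commutes with \<open>({}, a)\<close>, that is, if translation by \<open>a\<close> maps \<open>L\<close>
  to itself, that is, if \<open>a \<in> L\<close>.  The wreath product is again a 2-group, so a subgroup can be
  told apart from an element outside it by two homomorphisms without leaving the 2-groups.
\<close>

lemma separate_from_subgroup:
  assumes Q: "order G = 2 ^ k" and L: "subgroup L G" and g: "g \<in> carrier G" "g \<notin> L"
  shows "\<exists>f f'. f \<in> hom G (subset_wreath G) \<and> f' \<in> hom G (subset_wreath G) \<and>
    (\<forall>a\<in>L. f a = f' a) \<and> f g \<noteq> f' g"
proof -
  interpret L: subgroup L G by fact
  define F where "F A g = ({x \<in> carrier G. (x \<in> A) \<noteq> (inv g \<otimes> x \<in> A)}, g)" for A g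
  have "F L a = F {} a" if a: "a \<in> L" for a
  proof -
    have "inv a \<otimes> x \<in> L \<longleftrightarrow> x \<in> L" if x: "x \<in> carrier G" for x
    proof
      assume "inv a \<otimes> x \<in> L"
      then have "a \<otimes> (inv a \<otimes> x) \<in> L" using a by simp
      then show "x \<in> L"
        using a x m_assoc[of a "inv a" x] by simp
    qed (use a in simp)
    then show ?thesis by (auto simp: F_def)
  qed
  moreover have "F L g \<noteq> F {} g"
    using g by (auto simp: F_def set_eq_iff intro!: exI[of _ g])
  moreover have "F L \<in> hom G (subset_wreath G)" "F {} \<in> hom G (subset_wreath G)"
    unfolding F_def by (intro subset_wreath_embedding L.subset empty_subsetI)+
  ultimately show ?thesis by blast
qed

end

section \<open>Free products are topologically generated by their factors\<close>

lemma prod_topology_discrete: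
  "prod_topology (discrete_topology A) (discrete_topology B) = discrete_topology (A \<times> B)"
proof -
  have "openin (prod_topology (discrete_topology A) (discrete_topology B)) {(a, b)}"
    if "a \<in> A" "b \<in> B" for a b
    using that openin_prod_Times_iff[of "discrete_topology A" "discrete_topology B" "{a}" "{b}"] by simp
  then show ?thesis
    using discrete_topology_unique[of "A \<times> B"] by (metis SigmaE topspace_discrete_topology topspace_prod_topology)
qed

lemma pro2_group_discrete:
  assumes "group R" and order: "order R = 2 ^ k"
  shows "pro2_group R (discrete_topology (carrier R))"
proof -
  interpret R: group R by fact
  have "finite (carrier R)"
    using order by (rule finite_carrier_if_order_power)
  moreover have "\<exists>j. card (rcosets\<^bsub>R\<^esub> N) = 2 ^ j" if "N \<lhd> R" for N
  proof -
    have "card (rcosets\<^bsub>R\<^esub> N) dvd 2 ^ k"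
      using R.lagrange[OF normal_imp_subgroup[OF that]] order by (metis dvd_triv_left)
    then show ?thesis by (auto simp: divides_primepow_nat)
  qed
  ultimately show ?thesis
    using \<open>group R\<close>
    by (auto simp: pro2_group_def topological_group_def prod_topology_discrete compact_space_discrete_topology
        connectedin_discrete_topology)
qed

lemma small_isomorphic_copy:
  assumes "finite (carrier R)"
  obtains e :: "'a \<Rightarrow> nat set" where "inj_on e (carrier R)"
proof -
  obtain f :: "'a \<Rightarrow> nat" where "inj_on f (carrier R)"
    using finite_imp_inj_to_nat_seg[OF assms] by blast
  then have "inj_on (\<lambda>a. {f a}) (carrier R)"
    by (auto simp: inj_on_def)
  then show thesis by (rule that)
qed

lemma ex1_unique: "\<exists>!x. P x \<Longrightarrow> P a \<Longrightarrow> P b \<Longrightarrow> a = b"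
  by blast

lemma continuous_hom_compose:
  assumes "f \<in> continuous_hom G T K S" "g \<in> continuous_hom K S L U"
  shows "g \<circ> f \<in> continuous_hom G T L U"
  using assms hom_compose[of f G K g L] continuous_map_compose[of T S f U g]
  by (auto simp: continuous_hom_def)

lemma continuous_hom_restrict:
  assumes "f \<in> continuous_hom G T K S" "group G" "topspace T = carrier G"
  shows "restrict f (carrier G) \<in> continuous_hom G T K S"
proof -
  interpret group G by fact
  have "continuous_map T S (restrict f (carrier G))"
    using assms by (auto simp: continuous_hom_def intro: continuous_map_eq)
  then show ?thesis
    using assms(1) by (auto simp: continuous_hom_def hom_def)
qed

lemma hom_imp_continuous_hom_discrete:
  assumes "f \<in> hom R K" "topspace S = carrier K"
  shows "f \<in> continuous_hom R (discrete_topology (carrier R)) K S"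
  using assms by (auto simp: continuous_hom_def hom_def)

text \<open>
  A finite group of any type has an isomorphic copy whose elements have type \<open>nat set\<close>, to which
  the universal property applies.
\<close>

lemma free_product_universal_finite:
  assumes free: "pro2_free_product TYPE(nat set) I A TA \<iota> G T"
    and R: "group R" "order R = 2 ^ k"
    and f: "\<And>i. i \<in> I \<Longrightarrow> f i \<in> continuous_hom (A i) (TA i) R (discrete_topology (carrier R))"
  shows "\<exists>!g. g \<in> extensional (carrier G) \<and>
    g \<in> continuous_hom G T R (discrete_topology (carrier R)) \<and>
    (\<forall>i\<in>I. \<forall>a\<in>carrier (A i). g (\<iota> i a) = f i a)"
proof -
  let ?D = "\<lambda>R. discrete_topology (carrier R)"
  interpret R: group R by fact
  have GT: "group G" "topspace T = carrier G"
    and \<iota>: "\<And>i. i \<in> I \<Longrightarrow> \<iota> i \<in> continuous_hom (A i) (TA i) G T"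
    using free by (auto simp: pro2_free_product_def pro2_group_def topological_group_def)
  have \<iota>G: "\<iota> i a \<in> carrier G" if "i \<in> I" "a \<in> carrier (A i)" for i a
    using \<iota>[OF that(1)] that(2) by (auto simp: continuous_hom_def hom_def)
  have "finite (carrier R)"
    using R(2) by (rule finite_carrier_if_order_power)
  then obtain e :: "'e \<Rightarrow> nat set" where e: "inj_on e (carrier R)"
    by (rule small_isomorphic_copy)
  define P where "P = image_group e R"
  define e' where "e' = inv_into (carrier R) e"
  have P: "group P"
    unfolding P_def by (rule R.inj_imp_image_group_is_group[OF e])
  have eP: "e \<in> iso R P"
    unfolding P_def by (rule inj_imp_image_group_iso[OF e])
  then have e'P: "e' \<in> iso P R"
    unfolding e'_def by (rule R.iso_set_sym)
  have "order P = 2 ^ k"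
    using R(2) card_image[OF e] by (simp add: P_def order_def image_group_carrier)
  then have "pro2_group P (?D P)"
    using P by (intro pro2_group_discrete)
  moreover have e_cont: "e \<in> continuous_hom R (?D R) P (?D P)" "e' \<in> continuous_hom P (?D P) R (?D R)"
    using eP e'P by (auto intro: hom_imp_continuous_hom_discrete simp: iso_def)
  ultimately have ex1: "\<exists>!g. g \<in> extensional (carrier G) \<and> g \<in> continuous_hom G T P (?D P) \<and>
      (\<forall>i\<in>I. \<forall>a\<in>carrier (A i). g (\<iota> i a) = (e \<circ> f i) a)"
  proof -
    have "\<forall>i\<in>I. e \<circ> f i \<in> continuous_hom (A i) (TA i) P (?D P)"
      using continuous_hom_compose[OF f e_cont(1)] by simp
    then show ?thesis
      using free \<open>pro2_group P (?D P)\<close> by (simp only: pro2_free_product_def)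
  qed
  then obtain g where g: "g \<in> continuous_hom G T P (?D P)"
    "\<And>i a. i \<in> I \<Longrightarrow> a \<in> carrier (A i) \<Longrightarrow> g (\<iota> i a) = e (f i a)"
    by auto
  have fR: "f i a \<in> carrier R" if "i \<in> I" "a \<in> carrier (A i)" for i a
    using f[OF that(1)] that(2) by (auto simp: continuous_hom_def hom_def)
  show ?thesis
  proof (rule ex_ex1I)
    have "restrict (e' \<circ> g) (carrier G) \<in> continuous_hom G T R (?D R)"
      using continuous_hom_compose[OF g(1) e_cont(2)] GT by (rule continuous_hom_restrict)
    moreover have "e' (g (\<iota> i a)) = f i a" if "i \<in> I" "a \<in> carrier (A i)" for i a
      using that g(2) fR e by (simp add: e'_def)
    ultimately show "\<exists>g. g \<in> extensional (carrier G) \<and> g \<in> continuous_hom G T R (?D R) \<and>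
        (\<forall>i\<in>I. \<forall>a\<in>carrier (A i). g (\<iota> i a) = f i a)"
      using \<iota>G by (intro exI[of _ "restrict (e' \<circ> g) (carrier G)"]) auto
  next
    fix g h
    assume "g \<in> extensional (carrier G) \<and> g \<in> continuous_hom G T R (?D R) \<and>
        (\<forall>i\<in>I. \<forall>a\<in>carrier (A i). g (\<iota> i a) = f i a)"
      "h \<in> extensional (carrier G) \<and> h \<in> continuous_hom G T R (?D R) \<and>
        (\<forall>i\<in>I. \<forall>a\<in>carrier (A i). h (\<iota> i a) = f i a)"
    then have g: "g \<in> extensional (carrier G)" "g \<in> continuous_hom G T R (?D R)"
        "\<And>i a. i \<in> I \<Longrightarrow> a \<in> carrier (A i) \<Longrightarrow> g (\<iota> i a) = f i a"
      and h: "h \<in> extensional (carrier G)" "h \<in> continuous_hom G T R (?D R)"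
        "\<And>i a. i \<in> I \<Longrightarrow> a \<in> carrier (A i) \<Longrightarrow> h (\<iota> i a) = f i a"
      by auto
    have "restrict (e \<circ> g) (carrier G) \<in> continuous_hom G T P (?D P)"
         "restrict (e \<circ> h) (carrier G) \<in> continuous_hom G T P (?D P)"
      using continuous_hom_compose[OF g(2) e_cont(1)] continuous_hom_compose[OF h(2) e_cont(1)] GT
      by (auto intro: continuous_hom_restrict)
    then have eq: "restrict (e \<circ> g) (carrier G) = restrict (e \<circ> h) (carrier G)"
      using g(3) h(3) \<iota>G by (intro ex1_unique[OF ex1]) auto
    show "g = h"
    proof (rule extensionalityI[OF g(1) h(1)])
      fix a assume a: "a \<in> carrier G"
      then have "e (g a) = e (h a)"
        using fun_cong[OF eq, of a] by simp
      moreover have "g a \<in> carrier R" "h a \<in> carrier R"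
        using g(2) h(2) a by (auto simp: continuous_hom_def hom_def)
      ultimately show "g a = h a"
        using e by (auto dest: inj_onD)
    qed
  qed
qed

lemma pro2_group_imp_compact_group: "pro2_group G T \<Longrightarrow> compact_group G T"
  by (simp add: pro2_group_def topological_group_def compact_group_def compact_group_axioms_def)

text \<open>
  A proper closed subgroup \<open>K\<close> remains proper in some finite quotient \<open>Q\<close> of \<open>G\<close>.  If it
  contained the factors, then the two homomorphisms that separate its image in \<open>Q\<close> from an
  outside element would be different on \<open>G\<close> but equal on the factors, against uniqueness in the
  universal property.
\<close>

theorem free_product_topologically_generated:
  fixes G (structure)
  assumes free: "pro2_free_product TYPE(nat set) I A TA \<iota> G T"
    and K: "subgroup K G" "closedin T K"
    and \<iota>K: "\<And>i a. i \<in> I \<Longrightarrow> a \<in> carrier (A i) \<Longrightarrow> \<iota> i a \<in> K"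
  shows "K = carrier G"
proof (rule ccontr)
  have pro2: "pro2_group G T"
    using free by (simp add: pro2_free_product_def)
  interpret compact_group G T
    using pro2 by (rule pro2_group_imp_compact_group)
  interpret K: subgroup K G by fact
  assume "K \<noteq> carrier G"
  then obtain g where g: "g \<in> carrier G" "g \<notin> K" using K.subset by blast
  \<comment> \<open>the set of all \<open>g \<otimes> inv a\<close> with \<open>a \<in> K\<close>; a normal subgroup that misses it separates
    the coset of \<open>g\<close> from those of \<open>K\<close>\<close>
  have "continuous_map T T (\<lambda>u. inv u \<otimes> g)"
    using g by (intro continuous_map_mult continuous_map_inv) auto
  then have "closedin T {u \<in> carrier G. inv u \<otimes> g \<in> K}"
    using K(2) closedin_continuous_map_preimage[of T T _ K] by simp
  then obtain N where N: "N \<lhd> G" "openin T N" "N \<inter> {u \<in> carrier G. inv u \<otimes> g \<in> K} = {}"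
    using open_normal_subgroup_disjoint[of "{u \<in> carrier G. inv u \<otimes> g \<in> K}"] g pro2
    by (auto simp: pro2_group_def)
  interpret N: normal N G by (rule N(1))
  let ?Q = "G Mod N"
  let ?q = "\<lambda>a. N #> a"
  interpret Q: group ?Q by (rule N.factorgroup_is_group)
  interpret q: group_hom G ?Q ?q
    using N.r_coset_hom_Mod by unfold_locales
  obtain k where k: "order ?Q = 2 ^ k"
    using pro2 N by (auto simp: pro2_group_def order_def FactGroup_def)
  have "?q g \<notin> ?q ` K"
  proof
    assume "?q g \<in> ?q ` K"
    then obtain a where a: "a \<in> K" "?q g = ?q a" by auto
    then have aG: "a \<in> carrier G" using K.mem_carrier by simp
    have "g \<otimes> inv a \<in> N"
      using rcos_self[OF g(1) N.subgroup_axioms] a(2) N.rcos_module_imp[OF is_group aG] by simp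
    moreover have "inv (g \<otimes> inv a) \<otimes> g = a"
      using g aG by (simp add: inv_mult_group m_assoc)
    ultimately show False
      using N(3) a(1) N.mem_carrier by auto
  qed
  moreover have "subgroup (?q ` K) ?Q"
    using q.subgroup_img_is_subgroup[OF K(1)] .
  ultimately obtain f f' where f: "f \<in> hom ?Q (subset_wreath ?Q)" "f' \<in> hom ?Q (subset_wreath ?Q)"
    "\<forall>a\<in>?q ` K. f a = f' a" "f (?q g) \<noteq> f' (?q g)"
    using Q.separate_from_subgroup[OF k] g q.hom_closed by metis
  let ?W = "subset_wreath ?Q"
  have q_cont: "?q \<in> continuous_hom G T ?Q (discrete_topology (carrier ?Q))"
  proof -
    have "continuous_map T (discrete_topology (carrier ?Q)) ?q"
      unfolding continuous_map_def
    proof (intro conjI allI impI)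
      fix W assume "openin (discrete_topology (carrier ?Q)) W"
      show "openin T {a \<in> topspace T. ?q a \<in> W}"
      proof (subst openin_subopen, intro ballI)
        fix a assume "a \<in> {a \<in> topspace T. ?q a \<in> W}"
        then have a: "a \<in> carrier G" "?q a \<in> W" by auto
        have "continuous_map T T (\<lambda>b. b \<otimes> inv a)"
          using a by (intro continuous_map_mult) auto
        then have "openin T {b \<in> carrier G. b \<otimes> inv a \<in> N}"
          using N(2) openin_continuous_map_preimage[of T T _ N] by simp
        moreover have "{b \<in> carrier G. b \<otimes> inv a \<in> N} \<subseteq> {b \<in> topspace T. ?q b \<in> W}"
        proof clarsimp
          fix b assume b: "b \<in> carrier G" "b \<otimes> inv a \<in> N"
          have "?q a = ?q b"
            using repr_independence[OF N.rcos_module_rev[OF is_group a(1) b] a(1) N.subgroup_axioms] .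
          then show "?q b \<in> W"
            using a(2) by simp
        qed
        moreover have "a \<in> {b \<in> carrier G. b \<otimes> inv a \<in> N}"
          using a(1) by simp
        ultimately show "\<exists>V. openin T V \<and> a \<in> V \<and> V \<subseteq> {a \<in> topspace T. ?q a \<in> W}"
          by blast
      qed
    qed (use q.hom_closed in auto)
    then show ?thesis using q.homh by (simp add: continuous_hom_def)
  qed
  have fq: "f \<circ> ?q \<in> continuous_hom G T ?W (discrete_topology (carrier ?W))"
    "f' \<circ> ?q \<in> continuous_hom G T ?W (discrete_topology (carrier ?W))"
    by (intro continuous_hom_compose[OF q_cont] hom_imp_continuous_hom_discrete f(1,2)
        topspace_discrete_topology)+
  have ex1: "\<exists>!h. h \<in> extensional (carrier G) \<and> h \<in> continuous_hom G T ?W (discrete_topology (carrier ?W)) \<and>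
      (\<forall>i\<in>I. \<forall>a\<in>carrier (A i). h (\<iota> i a) = (f \<circ> ?q \<circ> \<iota> i) a)"
    using free Q.group_subset_wreath Q.order_subset_wreath[OF k]
  proof (rule free_product_universal_finite)
    fix i assume "i \<in> I"
    then have "\<iota> i \<in> continuous_hom (A i) (TA i) G T"
      using free by (auto simp: pro2_free_product_def)
    then show "f \<circ> ?q \<circ> \<iota> i \<in> continuous_hom (A i) (TA i) ?W (discrete_topology (carrier ?W))"
      using fq(1) continuous_hom_compose by blast
  qed
  have "restrict (f \<circ> ?q) (carrier G) \<in> extensional (carrier G) \<and>
      restrict (f \<circ> ?q) (carrier G) \<in> continuous_hom G T ?W (discrete_topology (carrier ?W)) \<and>
      (\<forall>i\<in>I. \<forall>a\<in>carrier (A i). restrict (f \<circ> ?q) (carrier G) (\<iota> i a) = (f \<circ> ?q \<circ> \<iota> i) a)"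
    using continuous_hom_restrict[OF fq(1) is_group topspace] \<iota>K K.mem_carrier by simp
  moreover have "restrict (f' \<circ> ?q) (carrier G) \<in> extensional (carrier G) \<and>
      restrict (f' \<circ> ?q) (carrier G) \<in> continuous_hom G T ?W (discrete_topology (carrier ?W)) \<and>
      (\<forall>i\<in>I. \<forall>a\<in>carrier (A i). restrict (f' \<circ> ?q) (carrier G) (\<iota> i a) = (f \<circ> ?q \<circ> \<iota> i) a)"
    using continuous_hom_restrict[OF fq(2) is_group topspace] \<iota>K K.mem_carrier f(3) by simp
  ultimately have "restrict (f \<circ> ?q) (carrier G) = restrict (f' \<circ> ?q) (carrier G)"
    by (rule ex1_unique[OF ex1])
  from fun_cong[OF this, of g] show False
    using g(1) f(4) by simp
qed

section \<open>Split subgroups of index two\<close>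

context compact_group
begin

lemma compact_group_closed_subgroup:
  assumes "closed_subgroup H"
  shows "compact_group (G\<lparr>carrier := H\<rparr>) (subtopology T H)"
proof -
  interpret H: subgroup H G using assms by simp
  let ?GH = "G\<lparr>carrier := H\<rparr>" and ?TH = "subtopology T H"
  have GH: "group ?GH" by (rule H.subgroup_is_group[OF is_group])
  have top: "topspace ?TH = H"
    using H.subset by (simp add: Int_absorb1)
  have mult: "continuous_map (prod_topology T T) T (\<lambda>(a, b). a \<otimes> b)"
    using topological_group by (simp add: topological_group_def)
  have "continuous_map (prod_topology ?TH ?TH) ?TH (\<lambda>(a, b). a \<otimes> b)"
    using continuous_map_from_subtopology[OF mult, of "H \<times> H"] top
    by (auto simp: continuous_map_in_subtopology subtopology_Times[symmetric])
  moreover have "continuous_map ?TH ?TH (\<lambda>a. inv\<^bsub>?GH\<^esub> a)"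
  proof -
    have "continuous_map ?TH ?TH (\<lambda>a. inv a)"
      using continuous_map_from_subtopology[OF continuous_map_inv[OF continuous_map_id[unfolded id_def]], of H] top
      by (auto simp: continuous_map_in_subtopology)
    then show ?thesis
      by (rule continuous_map_eq) (use top assms in simp)
  qed
  ultimately show ?thesis
    using GH top compact Hausdorff assms
    by (simp add: compact_group_def compact_group_axioms_def topological_group_def
        Hausdorff_space_subtopology closedin_compact_space compact_space_subtopology)
qed

lemma closed_subgroup_trans:
  assumes H: "closed_subgroup H"
    and K: "subgroup K (G\<lparr>carrier := H\<rparr>)" "closedin (subtopology T H) K"
  shows "closed_subgroup K"
  using incl_subgroup[of H K] closedin_trans_full[of T H K] H K by simp

lemma inclusion_continuous_hom:
  assumes "closed_subgroup H"
  shows "(\<lambda>a. a) \<in> continuous_hom (G\<lparr>carrier := H\<rparr>) (subtopology T H) G T"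
  using assms subgroup.subset[of H G] continuous_map_from_subtopology[OF continuous_map_id[unfolded id_def]]
  by (auto simp: continuous_hom_def hom_def)

end

text \<open>
  \<open>G\<close> is the semidirect product of its closed subgroup \<open>H\<close> and the group of order two generated
  by \<open>x\<close>.
\<close>

locale index_two_split = compact_group +
  fixes H x
  assumes H: "closed_subgroup H"
    and x: "x \<in> carrier G" "x \<notin> H" "x \<otimes> x = \<one>"
    and cover: "\<And>g. g \<in> carrier G \<Longrightarrow> g \<in> H \<or> g \<otimes> x \<in> H"
    and conj_mem: "\<And>h. h \<in> H \<Longrightarrow> x \<otimes> h \<otimes> x \<in> H"
begin

abbreviation "GH \<equiv> G\<lparr>carrier := H\<rparr>"
abbreviation "TH \<equiv> subtopology T H"

sublocale HH: compact_group GH TH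
  using H by (rule compact_group_closed_subgroup)

sublocale HS: subgroup H G
  using H by simp

lemma inv_x: "inv x = x"
  using x by (simp add: inv_equality)

lemma x_x_mult: "a \<in> carrier G \<Longrightarrow> x \<otimes> (x \<otimes> a) = a"
  using x m_assoc[of x x a] by simp

lemma mult_x_x: "a \<in> carrier G \<Longrightarrow> a \<otimes> x \<otimes> x = a"
  using x by (simp add: m_assoc)

lemma mult_x_mem_iff:
  assumes "g \<in> carrier G"
  shows "g \<otimes> x \<in> H \<longleftrightarrow> g \<notin> H"
proof
  assume gx: "g \<otimes> x \<in> H"
  show "g \<notin> H"
  proof
    assume "g \<in> H"
    then have "inv g \<otimes> (g \<otimes> x) \<in> H" using gx by simp
    then show False using x assms by (simp add: l_inv_cancel)
  qed
qed (use cover[OF assms] in blast)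

lemma conj_continuous_hom: "(\<lambda>h. x \<otimes> h \<otimes> x) \<in> continuous_hom GH TH GH TH"
proof -
  have *: "(\<lambda>h. x \<otimes> h \<otimes> x) \<in> continuous_hom G T G T"
    using conjugation_continuous_hom[OF x(1)] by (simp add: inv_x)
  then have "continuous_map TH TH (\<lambda>h. x \<otimes> h \<otimes> x)"
    using conj_mem by (auto simp: continuous_hom_def continuous_map_in_subtopology continuous_map_from_subtopology)
  then show ?thesis
    using * conj_mem by (auto simp: continuous_hom_def hom_def)
qed

lemma commutator_GH:
  "a \<in> H \<Longrightarrow> b \<in> H \<Longrightarrow> HH.commutator a b = commutator a b"
  using H by simp

lemma Z_GH_subset_Z: "HH.Z n \<subseteq> Z n"
  using HH.Z_functorial[OF inclusion_continuous_hom[OF H] compact_group_axioms] by blast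

lemma closed_subgroup_Z_GH: "closed_subgroup (HH.Z n)"
  using closed_subgroup_trans[OF H] HH.closed_subgroup_Z by blast

text \<open>
  Elements outside \<open>H\<close> enter the filtration of \<open>G\<close> only through squares of elements of \<open>G\<close> and
  commutators with elements of \<open>G\<close>.  Conjugation by \<open>x\<close> acts trivially on every factor of the
  filtration of \<open>H\<close>, so the commutator of \<open>h \<otimes> x\<close> with an element of level \<open>n - 1\<close> differs from
  a commutator in \<open>H\<close> by an element of level \<open>n\<close>; and \<open>(h \<otimes> x) \<otimes> (h \<otimes> x)\<close> equals
  \<open>h \<otimes> h\<close> up to level 2.  As \<open>G\<close> and \<open>H\<close> differ, so do the terms at index 1;
  hence the case \<open>n = 2\<close> has to be treated without an induction hypothesis, and there commutators are products of squares.
\<close>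

theorem Z_eq_Z_GH:
  assumes triv: "\<And>h. h \<in> H \<Longrightarrow> (x \<otimes> h \<otimes> x) \<otimes> inv h \<in> HH.Z 2"
  shows "2 \<le> n \<Longrightarrow> Z n = HH.Z n"
proof (induction n rule: less_induct)
  case (less n)
  have HZ: "HH.Z m \<subseteq> H" for m using HH.Z_subset by simp
  have conj_Z: "x \<otimes> h \<otimes> x \<otimes> inv h \<in> HH.Z (Suc m)" if "1 \<le> m" "h \<in> HH.Z m" for m h
  proof -
    have "x \<otimes> h \<otimes> x \<otimes>\<^bsub>GH\<^esub> inv\<^bsub>GH\<^esub> h \<in> HH.Z (Suc m)"
      using conj_continuous_hom _ that
      by (rule HH.trivial_action_on_factors) (use triv H in simp)
    then show ?thesis
      using HZ[of m] that(2) H by auto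
  qed
  have square: "a \<otimes> a \<in> HH.Z n" if "a \<in> HH.Z ((n + 1) div 2)" for a
    using HH.square_mem_Z[OF less.prems that] by simp
  have comm: "commutator a b \<in> HH.Z n" if "1 \<le> i" "1 \<le> j" "i + j = n" "a \<in> HH.Z i" "b \<in> HH.Z j" for i j a b
  proof -
    have "a \<in> H" "b \<in> H" using that HZ by blast+
    then show ?thesis
      using HH.commutator_mem_Z[OF that(1,2,4,5)] that(3) commutator_GH[of a b] by simp
  qed
  have "Z n \<subseteq> HH.Z n"
  proof (cases "n = 2")
    case True
    interpret Z2: subgroup "HH.Z 2" G using closed_subgroup_Z_GH by blast
    have squares: "g \<otimes> g \<in> HH.Z 2" if g: "g \<in> carrier G" for g
    proof (cases "g \<in> H")
      case True
      then show ?thesis using square \<open>n = 2\<close> by (simp add: HH.Z_le_1)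
    next
      case False
      define h where "h = g \<otimes> x"
      define c where "c = x \<otimes> h \<otimes> x \<otimes> inv h"
      have h: "h \<in> H" "h \<in> carrier G" and gh: "g = h \<otimes> x"
        using False g x by (simp_all add: h_def mult_x_mem_iff mult_x_x)
      have c: "c \<in> HH.Z 2" unfolding c_def using h(1) by (rule triv)
      then have cG: "c \<in> carrier G" by (rule Z2.mem_carrier)
      interpret Z2': normal "HH.Z 2" GH using HH.closed_normal_Z by blast
      have "inv h \<otimes> c \<otimes> h \<in> HH.Z 2"
        using Z2'.inv_op_closed1[of h c] h c H by simp
      moreover have "h \<otimes> h \<in> HH.Z 2"
        using square[of h] \<open>n = 2\<close> h by (simp add: HH.Z_le_1)
      ultimately have "h \<otimes> h \<otimes> (inv h \<otimes> c \<otimes> h) \<in> HH.Z 2"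
        by simp
      also have "h \<otimes> h \<otimes> (inv h \<otimes> c \<otimes> h) = h \<otimes> (c \<otimes> h)"
        using h cG m_assoc[of h "inv h" "c \<otimes> h"] by (simp add: m_assoc)
      also have "c \<otimes> h = x \<otimes> h \<otimes> x"
        using h x by (simp add: c_def m_assoc)
      also have "h \<otimes> (x \<otimes> h \<otimes> x) = g \<otimes> g"
        using h x by (simp add: gh m_assoc)
      finally show ?thesis .
    qed
    show ?thesis
      unfolding True
    proof (rule Z_least[OF _ closed_subgroup_Z_GH])
      fix i j a b assume "a \<in> Z i" "b \<in> Z j"
      then have [simp]: "a \<in> carrier G" "b \<in> carrier G" using Z_subset by blast+
      have "inv a \<otimes> inv a \<otimes> ((a \<otimes> inv b) \<otimes> (a \<otimes> inv b)) \<otimes> (b \<otimes> b) \<in> HH.Z 2"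
        by (intro Z2.m_closed squares) simp_all
      also have "inv a \<otimes> inv a \<otimes> ((a \<otimes> inv b) \<otimes> (a \<otimes> inv b)) \<otimes> (b \<otimes> b) = commutator a b"
        by (simp add: m_assoc l_inv_cancel)
      finally show "commutator a b \<in> HH.Z 2" .
    qed (use squares Z_subset in \<open>auto simp: Z_le_1\<close>)
  next
    case False
    then have n: "3 \<le> n" using less.prems by simp
    interpret Zn: subgroup "HH.Z n" G using closed_subgroup_Z_GH by blast
    have comm_1: "commutator a b \<in> HH.Z n" if a: "a \<in> carrier G" and b: "b \<in> HH.Z (n - 1)" for a b
    proof (cases "a \<in> H")
      case True
      then show ?thesis
        using comm[of 1 "n - 1" a b] b n by (simp add: HH.Z_le_1)
    next
      case False
      have bH: "b \<in> H" using b HZ by blast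
      define h where "h = a \<otimes> x"
      have hH: "h \<in> H" "h \<in> carrier G" "b \<in> carrier G" using False a bH by (simp_all add: h_def mult_x_mem_iff)
      have ah: "a = h \<otimes> x" using a by (simp add: h_def mult_x_x)
      interpret Zn1: normal "HH.Z (n - 1)" GH using HH.closed_normal_Z by blast
      define b' where "b' = inv h \<otimes> inv b \<otimes> h"
      have "inv b \<in> HH.Z (n - 1)"
        using Zn1.m_inv_closed[OF b] bH H by simp
      then have b': "b' \<in> HH.Z (n - 1)"
        using Zn1.inv_op_closed1[of h "inv b"] hH H by (simp add: b'_def)
      then have b'G: "b' \<in> carrier G" using HZ HS.mem_carrier by blast
      have "x \<otimes> b' \<otimes> x \<otimes> inv b' \<in> HH.Z n"
        using conj_Z[OF _ b'] n by simp
      moreover have "commutator h b \<in> HH.Z n"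
        using comm[of 1 "n - 1" h b] b n hH by (simp add: HH.Z_le_1)
      ultimately have "(x \<otimes> b' \<otimes> x \<otimes> inv b') \<otimes> commutator h b \<in> HH.Z n"
        by simp
      also have "commutator h b = b' \<otimes> b"
        by (simp add: b'_def)
      also have "(x \<otimes> b' \<otimes> x \<otimes> inv b') \<otimes> (b' \<otimes> b) = x \<otimes> b' \<otimes> x \<otimes> b"
        using b'G hH x(1) by (simp add: m_assoc l_inv_cancel)
      also have "\<dots> = commutator a b"
        unfolding ah b'_def using hH x(1) by (simp add: inv_mult_group inv_x m_assoc)
      finally show ?thesis .
    qed
    show ?thesis
    proof (rule Z_least[OF less.prems closed_subgroup_Z_GH])
      fix a assume "a \<in> Z ((n + 1) div 2)"
      moreover have "Z ((n + 1) div 2) = HH.Z ((n + 1) div 2)"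
        using n by (intro less.IH) auto
      ultimately show "a \<otimes> a \<in> HH.Z n"
        using square by simp
    next
      fix i j a b assume ij: "1 \<le> i" "1 \<le> j" "i + j = n" and ab: "a \<in> Z i" "b \<in> Z j"
      have G: "a \<in> carrier G" "b \<in> carrier G" using ab Z_subset by blast+
      consider "i = 1" "j = n - 1" | "i = n - 1" "j = 1" | "2 \<le> i" "2 \<le> j"
        using ij by linarith
      then show "commutator a b \<in> HH.Z n"
      proof cases
        case 1
        then have "b \<in> HH.Z (n - 1)"
          using less.IH[of "n - 1"] ab(2) n by simp
        with G(1) show ?thesis by (rule comm_1)
      next
        case 2
        then have "a \<in> HH.Z (n - 1)"
          using less.IH[of "n - 1"] ab(1) n by simp
        with G(2) have "commutator b a \<in> HH.Z n" by (rule comm_1)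
        then have "inv (commutator b a) \<in> HH.Z n" by (rule Zn.m_inv_closed)
        then show ?thesis using inv_commutator[OF G(2,1)] by simp
      next
        case 3
        then have "a \<in> HH.Z i" "b \<in> HH.Z j"
          using less.IH[of i] less.IH[of j] ij ab by auto
        with ij show ?thesis by (intro comm)
      qed
    qed
  qed
  then show ?case using Z_GH_subset_Z by blast
qed

end

section \<open>The quotient as a semidirect product\<close>

lemma carrier_C2: "carrier C2 = {0, 1}"
  by (auto simp: carrier_integer_mod_group)

lemma topspace_quotient_group_topology:
  assumes "topspace T = carrier G"
  shows "topspace (quotient_group_topology G T N) = rcosets\<^bsub>G\<^esub> N"
proof -
  have "{a \<in> carrier G. N #>\<^bsub>G\<^esub> a \<in> rcosets\<^bsub>G\<^esub> N} = topspace T"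
    using assms by (auto simp: RCOSETS_def)
  then have "openin (quotient_group_topology G T N) (rcosets\<^bsub>G\<^esub> N)"
    by (simp add: openin_quotient_group_topology[OF assms])
  moreover have "topspace (quotient_group_topology G T N) \<subseteq> rcosets\<^bsub>G\<^esub> N"
    using openin_topspace[of "quotient_group_topology G T N"]
    by (simp add: openin_quotient_group_topology[OF assms] del: openin_topspace)
  ultimately show ?thesis
    using openin_subset by blast
qed

lemma continuous_map_from_quotient:
  assumes T: "topspace T = carrier G"
    and f: "continuous_map T Y (\<lambda>a. f (N #>\<^bsub>G\<^esub> a))"
  shows "continuous_map (quotient_group_topology G T N) Y f"
  unfolding continuous_map_def
proof (intro conjI allI impI)
  show "f \<in> topspace (quotient_group_topology G T N) \<rightarrow> topspace Y"
    using f T by (auto simp: topspace_quotient_group_topology[OF T] RCOSETS_def continuous_map_def)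
  fix U assume U: "openin Y U"
  have "{a \<in> carrier G. N #>\<^bsub>G\<^esub> a \<in> {X \<in> rcosets\<^bsub>G\<^esub> N. f X \<in> U}} = {a \<in> topspace T. f (N #>\<^bsub>G\<^esub> a) \<in> U}"
    using T by (auto simp: RCOSETS_def)
  then have "openin T {a \<in> carrier G. N #>\<^bsub>G\<^esub> a \<in> {X \<in> rcosets\<^bsub>G\<^esub> N. f X \<in> U}}"
    using openin_continuous_map_preimage[OF f U] by simp
  then show "openin (quotient_group_topology G T N)
      {X \<in> topspace (quotient_group_topology G T N). f X \<in> U}"
    unfolding topspace_quotient_group_topology[OF T] openin_quotient_group_topology[OF T] by blast
qed

lemma continuous_map_quotient:
  assumes T: "topspace T = carrier G"
  shows "continuous_map T (quotient_group_topology G T N) (\<lambda>a. N #>\<^bsub>G\<^esub> a)"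
  unfolding continuous_map_def
  by (auto simp: topspace_quotient_group_topology[OF T] openin_quotient_group_topology[OF T] T RCOSETS_def)

context index_two_split
begin

lemma mult_mem_iff:
  assumes [simp]: "a \<in> carrier G" "b \<in> carrier G"
  shows "a \<otimes> b \<in> H \<longleftrightarrow> (a \<in> H \<longleftrightarrow> b \<in> H)"
proof (cases "a \<in> H")
  case True
  have "b \<in> H" if "a \<otimes> b \<in> H"
    using HS.m_closed[OF HS.m_inv_closed[OF True] that] by (simp add: l_inv_cancel)
  then show ?thesis
    using True by auto
next
  case False
  have "a \<in> H" if "a \<otimes> b \<in> H" "b \<in> H"
    using HS.m_closed[OF that(1) HS.m_inv_closed[OF that(2)]] by (simp add: m_assoc)
  moreover have "a \<otimes> b \<in> H" if "b \<notin> H"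
  proof -
    have "a \<otimes> x \<in> H" "b \<otimes> x \<in> H"
      using False that by (simp_all add: mult_x_mem_iff)
    then have "(a \<otimes> x) \<otimes> (x \<otimes> (b \<otimes> x) \<otimes> x) \<in> H"
      using conj_mem by simp
    then show ?thesis
      using x by (simp add: m_assoc x_x_mult)
  qed
  ultimately show ?thesis
    using False by auto
qed

lemma r_coset_GH [simp]: "N #>\<^bsub>GH\<^esub> a = N #> a"
  by (simp add: r_coset_def)

lemma set_mult_GH [simp]: "set_mult GH = set_mult G"
  by (intro ext) (simp add: set_mult_def)

lemma normal_GH:
  assumes N: "N \<lhd> G" "N \<subseteq> H"
  shows "N \<lhd> GH"
proof -
  interpret N: normal N G by (rule N(1))
  have "subgroup N GH"
    using subgroup_incl[OF N.subgroup_axioms HS.subgroup_axioms N(2)] .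
  then show ?thesis
    using N.inv_op_closed2 H HS.mem_carrier by (simp add: HH.normal_inv_iff)
qed

text \<open>
  Conjugation by \<open>x\<close> permutes the cosets of \<open>N\<close> as sets, so the action on the quotient can be
  defined by images, with no choice of representatives.
\<close>

lemma conj_image_coset:
  assumes N: "N \<lhd> G" and h: "h \<in> carrier G"
  shows "(\<lambda>a. x \<otimes> a \<otimes> x) ` (N #> h) = N #> (x \<otimes> h \<otimes> x)"
proof -
  interpret N: normal N G by (rule N)
  have conj: "x \<otimes> a \<otimes> x \<in> N" if "a \<in> N" for a
    using N.inv_op_closed2[OF x(1) that] by (simp add: inv_x)
  show ?thesis
  proof
    show "(\<lambda>a. x \<otimes> a \<otimes> x) ` (N #> h) \<subseteq> N #> (x \<otimes> h \<otimes> x)"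
    proof clarsimp
      fix b assume "b \<in> N #> h"
      then obtain a where a: "a \<in> N" "b = a \<otimes> h" by (auto simp: r_coset_def)
      have "x \<otimes> b \<otimes> x = (x \<otimes> a \<otimes> x) \<otimes> (x \<otimes> h \<otimes> x)"
        using a h x N.mem_carrier by (simp add: m_assoc x_x_mult)
      then show "x \<otimes> b \<otimes> x \<in> N #> (x \<otimes> h \<otimes> x)"
        using conj[OF a(1)] by (auto simp: r_coset_def)
    qed
    show "N #> (x \<otimes> h \<otimes> x) \<subseteq> (\<lambda>a. x \<otimes> a \<otimes> x) ` (N #> h)"
    proof
      fix b assume "b \<in> N #> (x \<otimes> h \<otimes> x)"
      then obtain a where a: "a \<in> N" "b = a \<otimes> (x \<otimes> h \<otimes> x)" by (auto simp: r_coset_def)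
      have "b = x \<otimes> ((x \<otimes> a \<otimes> x) \<otimes> h) \<otimes> x"
        using a h x N.mem_carrier by (simp add: m_assoc x_x_mult)
      moreover have "(x \<otimes> a \<otimes> x) \<otimes> h \<in> N #> h"
        using conj[OF a(1)] by (auto simp: r_coset_def)
      ultimately show "b \<in> (\<lambda>a. x \<otimes> a \<otimes> x) ` (N #> h)" by blast
    qed
  qed
qed

definition conj_action :: "'a set \<Rightarrow> int \<Rightarrow> 'a set \<Rightarrow> 'a set" where
  "conj_action N c = (\<lambda>X\<in>carrier (GH Mod N). if c = 0 then X else (\<lambda>a. x \<otimes> a \<otimes> x) ` X)"

lemma carrier_GH_Mod: "carrier (GH Mod N) = (\<lambda>h. N #> h) ` H"
  by (simp add: carrier_FactGroup)

lemma conj_action_coset: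
  assumes "N \<lhd> G" "h \<in> H"
  shows "conj_action N c (N #> h) = N #> (if c = 0 then h else x \<otimes> h \<otimes> x)"
  using assms conj_image_coset[of N h] by (simp add: conj_action_def carrier_GH_Mod)

lemma conj_action_hom:
  assumes N: "N \<lhd> G" "N \<subseteq> H"
  shows "conj_action N \<in> hom C2 (AutoGroup (GH Mod N))"
proof -
  let ?Q = "GH Mod N"
  interpret N: normal N G by (rule N(1))
  interpret NH: normal N GH by (rule normal_GH[OF N])
  note act = conj_action_coset[OF N(1)]
  have involution: "conj_action N c (conj_action N c X) = X"
    and closed: "conj_action N c X \<in> carrier ?Q" if "X \<in> carrier ?Q" for c X
  proof -
    obtain a where a: "a \<in> H" "X = N #> a"
      using \<open>X \<in> carrier ?Q\<close> by (auto simp: carrier_GH_Mod)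
    have "x \<otimes> (x \<otimes> a \<otimes> x) \<otimes> x = a"
      using a x by (simp add: m_assoc x_x_mult)
    then show "conj_action N c (conj_action N c X) = X"
      using a conj_mem by (simp add: act)
    show "conj_action N c X \<in> carrier ?Q"
      using a conj_mem by (simp add: act carrier_GH_Mod)
  qed
  have "conj_action N c \<in> hom ?Q ?Q" for c
  proof (rule homI[OF closed])
    fix X Y assume "X \<in> carrier ?Q" "Y \<in> carrier ?Q"
    then obtain a b where ab: "a \<in> H" "b \<in> H" "X = N #> a" "Y = N #> b"
      by (auto simp: carrier_GH_Mod)
    have "x \<otimes> a \<otimes> x \<otimes> (x \<otimes> b \<otimes> x) = x \<otimes> (a \<otimes> b) \<otimes> x"
      using ab x by (simp add: m_assoc x_x_mult)
    then show "conj_action N c (X \<otimes>\<^bsub>?Q\<^esub> Y) = conj_action N c X \<otimes>\<^bsub>?Q\<^esub> conj_action N c Y"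
      using ab conj_mem x by (simp add: act N.rcos_sum)
  qed
  moreover have "bij_betw (conj_action N c) (carrier ?Q) (carrier ?Q)" for c
    by (rule bij_betw_byWitness[where f' = "conj_action N c"]) (use involution closed in auto)
  moreover have "conj_action N c \<in> extensional (carrier ?Q)" for c
    by (simp add: conj_action_def)
  ultimately have auto: "conj_action N c \<in> auto ?Q" for c
    by (simp add: auto_def Bij_def)
  have compose: "conj_action N ((c + c') mod 2) = compose (carrier ?Q) (conj_action N c) (conj_action N c')"
    if "c \<in> {0, 1}" "c' \<in> {0, 1}" for c c'
  proof (rule extensionalityI[of _ "carrier ?Q"])
    fix X assume "X \<in> carrier ?Q"
    moreover have "conj_action N 0 Y = Y" if "Y \<in> carrier ?Q" for Y
      using that by (simp add: conj_action_def)
    ultimately show "conj_action N ((c + c') mod 2) X = compose (carrier ?Q) (conj_action N c) (conj_action N c') X"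
      using that involution[of X 1] closed[of X 1] by (auto simp: compose_def)
  qed (simp_all add: conj_action_def compose_def)
  show ?thesis
  proof (rule homI)
    show "conj_action N c \<in> carrier (AutoGroup ?Q)" for c
      using auto by (simp add: AutoGroup_def)
    fix c c' assume "c \<in> carrier C2" "c' \<in> carrier C2"
    then show "conj_action N (c \<otimes>\<^bsub>C2\<^esub> c') = conj_action N c \<otimes>\<^bsub>AutoGroup ?Q\<^esub> conj_action N c'"
      using compose auto by (simp add: carrier_C2 AutoGroup_def BijGroup_def auto_def)
  qed
qed

text \<open>
  The coset of \<open>h\<close> or \<open>h \<otimes> x\<close> with \<open>h \<in> H\<close> goes to the coset of \<open>h\<close>, paired with the number of
  factors \<open>x\<close>.  As \<open>N \<subseteq> H\<close>, a coset lies inside \<open>H\<close> or outside it as a whole.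
\<close>

definition split_map :: "'a set \<Rightarrow> 'a set \<times> int" where
  "split_map X = (if X \<subseteq> H then (X, 0) else (X #> x, 1))"

lemma split_map_coset:
  assumes N: "N \<lhd> G" "N \<subseteq> H" and g: "g \<in> carrier G"
  shows "split_map (N #> g) = (if g \<in> H then (N #> g, 0) else (N #> (g \<otimes> x), 1))"
proof -
  interpret N: normal N G by (rule N(1))
  have "N #> g \<subseteq> H \<longleftrightarrow> g \<in> H"
    using N(2) rcos_self[OF g N.subgroup_axioms] by (auto simp: r_coset_def)
  then show ?thesis
    using g x by (simp add: split_map_def coset_mult_assoc N.subset)
qed

lemma split_map_iso:
  assumes N: "N \<lhd> G" "N \<subseteq> H"
  shows "split_map \<in> iso (G Mod N) (semidirect_product (GH Mod N) (conj_action N) C2)"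
proof -
  let ?S = "semidirect_product (GH Mod N) (conj_action N) C2"
  interpret N: normal N G by (rule N(1))
  note split = split_map_coset[OF N]
  note act = conj_action_coset[OF N(1)]
  have S: "carrier ?S = ((\<lambda>h. N #> h) ` H) \<times> {0, 1}"
    by (simp add: semidirect_product_def carrier_GH_Mod carrier_C2)
  have G: "carrier (G Mod N) = (\<lambda>g. N #> g) ` carrier G"
    by (rule carrier_FactGroup)
  have "split_map \<in> hom (G Mod N) ?S"
  proof (rule homI)
    show "split_map X \<in> carrier ?S" if "X \<in> carrier (G Mod N)" for X
      using that by (auto simp: G S split mult_x_mem_iff)
    fix X Y assume "X \<in> carrier (G Mod N)" "Y \<in> carrier (G Mod N)"
    then obtain a b where ab [simp]: "a \<in> carrier G" "b \<in> carrier G" and XY: "X = N #> a" "Y = N #> b"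
      by (auto simp: G)
    have XY': "X \<otimes>\<^bsub>G Mod N\<^esub> Y = N #> (a \<otimes> b)"
      using XY by (simp add: N.rcos_sum)
    have ab_mem: "a \<otimes> b \<in> H \<longleftrightarrow> (a \<in> H \<longleftrightarrow> b \<in> H)"
      using ab by (rule mult_mem_iff)
    show "split_map (X \<otimes>\<^bsub>G Mod N\<^esub> Y) = split_map X \<otimes>\<^bsub>?S\<^esub> split_map Y"
      unfolding XY' unfolding XY
      using x by (simp add: split ab_mem semidirect_product_def act mult_x_mem_iff N.rcos_sum
          m_assoc x_x_mult)
  qed
  moreover have "inj_on split_map (carrier (G Mod N))"
  proof (rule inj_onI)
    fix X Y assume "X \<in> carrier (G Mod N)" "Y \<in> carrier (G Mod N)" and eq: "split_map X = split_map Y"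
    then obtain a b where ab [simp]: "a \<in> carrier G" "b \<in> carrier G" and XY: "X = N #> a" "Y = N #> b"
      by (auto simp: G)
    show "X = Y"
    proof (cases "a \<in> H")
      case True
      then show ?thesis using eq by (auto simp: XY split split: if_splits)
    next
      case False
      then have "N #> (a \<otimes> x) = N #> (b \<otimes> x)"
        using eq by (auto simp: XY split split: if_splits)
      then have "N #> (a \<otimes> x) #> x = N #> (b \<otimes> x) #> x" by simp
      then show ?thesis
        using x by (simp add: XY coset_mult_assoc N.subset mult_x_x)
    qed
  qed
  moreover have "carrier ?S \<subseteq> split_map ` carrier (G Mod N)"
  proof
    fix p assume "p \<in> carrier ?S"
    then obtain h c where p: "p = (N #> h, c)" "h \<in> H" "c = 0 \<or> c = 1"
      by (auto simp: S)
    show "p \<in> split_map ` carrier (G Mod N)"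
    proof (cases "c = 0")
      case True
      then have "p = split_map (N #> h)" using p by (simp add: split)
      then show ?thesis using p(2) by (simp add: G)
    next
      case False
      have "h \<otimes> x \<notin> H" using p(2) mult_x_mem_iff[of h] by simp
      then have "p = split_map (N #> (h \<otimes> x))"
        using p False x by (simp add: split mult_x_x)
      then show ?thesis using p(2) x by (simp add: G)
    qed
  qed
  ultimately show ?thesis
    by (auto simp: iso_def bij_betw_def hom_def)
qed

lemma openin_H: "openin T H"
proof -
  have "continuous_map T T (\<lambda>g. g \<otimes> x)"
    using x by (intro continuous_map_mult) auto
  then have "closedin T {g \<in> carrier G. g \<otimes> x \<in> H}"
    using closedin_continuous_map_preimage[of T T _ H] H by simp
  moreover have "{g \<in> carrier G. g \<otimes> x \<in> H} = topspace T - H"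
    using mult_x_mem_iff by auto
  ultimately show ?thesis
    using HS.subset by (simp add: openin_closedin_eq)
qed

text \<open>
  Since \<open>H\<close> is clopen, a set of cosets is open exactly if its part inside \<open>H\<close> and its part
  outside, translated back to \<open>H\<close> by \<open>x\<close>, are open.
\<close>

lemma split_map_homeomorphic:
  assumes N: "N \<lhd> G" "N \<subseteq> H"
  shows "homeomorphic_map (quotient_group_topology G T N)
    (prod_topology (quotient_group_topology GH TH N) C2_top) split_map"
proof -
  let ?QG = "quotient_group_topology G T N" and ?QH = "quotient_group_topology GH TH N"
  interpret N: normal N G by (rule N(1))
  note split = split_map_coset[OF N]
  have TH: "topspace TH = carrier GH" by (rule HH.topspace)
  have QG: "topspace ?QG = carrier (G Mod N)" and QH: "topspace ?QH = carrier (GH Mod N)"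
    by (simp_all add: topspace_quotient_group_topology[OF topspace] topspace_quotient_group_topology[OF TH]
        FactGroup_def)
  have right_mult: "continuous_map T T (\<lambda>g. g \<otimes> x)"
    using x by (intro continuous_map_mult) auto
  have "continuous_map ?QG (prod_topology ?QH C2_top) split_map"
  proof (rule continuous_map_from_quotient[OF topspace])
    have "continuous_map T TH (\<lambda>g. if g \<in> H then g else g \<otimes> x)"
      unfolding continuous_map_def
    proof (intro conjI allI impI)
      show "(\<lambda>g. if g \<in> H then g else g \<otimes> x) \<in> topspace T \<rightarrow> topspace TH"
        using HS.subset by (auto simp: mult_x_mem_iff)
      fix U assume "openin TH U"
      then obtain V where V: "openin T V" "U = V \<inter> H"
        by (auto simp: openin_subtopology)
      have "openin T {g \<in> topspace T. g \<otimes> x \<in> V}"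
        using right_mult V(1) by (rule openin_continuous_map_preimage)
      moreover have "openin T (topspace T - H)"
        using H by blast
      ultimately have "openin T ((V \<inter> H) \<union> ({g \<in> topspace T. g \<otimes> x \<in> V} \<inter> (topspace T - H)))"
        using V(1) openin_H by blast
      also have "(V \<inter> H) \<union> ({g \<in> topspace T. g \<otimes> x \<in> V} \<inter> (topspace T - H))
          = {g \<in> topspace T. (if g \<in> H then g else g \<otimes> x) \<in> U}"
        using V(2) HS.subset by (auto simp: mult_x_mem_iff)
      finally show "openin T {g \<in> topspace T. (if g \<in> H then g else g \<otimes> x) \<in> U}" .
    qed
    from continuous_map_compose[OF this continuous_map_quotient[OF TH]]
    have 1: "continuous_map T ?QH (\<lambda>g. N #> (if g \<in> H then g else g \<otimes> x))"
      by (simp add: o_def)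
    have "continuous_map T C2_top (\<lambda>g. if g \<in> H then 0 else 1)"
      unfolding continuous_map_def
    proof (intro conjI allI impI)
      fix W
      have "openin T ((if 0 \<in> W then H else {}) \<union> (if (1::int) \<in> W then topspace T - H else {}))"
      proof -
        have "openin T (topspace T - H)"
          using H by blast
        then show ?thesis
          using openin_H by (intro openin_Un) (simp_all del: topspace)
      qed
      also have "(if 0 \<in> W then H else {}) \<union> (if 1 \<in> W then topspace T - H else {})
          = {g \<in> topspace T. (if g \<in> H then 0 else 1) \<in> W}"
        using HS.subset by auto
      finally show "openin T {g \<in> topspace T. (if g \<in> H then 0 else 1) \<in> W}" .
    qed (simp add: carrier_C2)
    from continuous_map_pairedI[OF 1 this]
    show "continuous_map T (prod_topology ?QH C2_top) (\<lambda>g. split_map (N #> g))"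
      by (rule continuous_map_eq) (simp add: split)
  qed
  moreover have "open_map ?QG (prod_topology ?QH C2_top) split_map"
    unfolding open_map_def
  proof (intro allI impI)
    fix U assume "openin ?QG U"
    then have U: "U \<subseteq> carrier (G Mod N)" "openin T {g \<in> carrier G. N #> g \<in> U}"
      by (simp_all add: openin_quotient_group_topology[OF topspace] FactGroup_def)
    \<comment> \<open>the slice of the image of \<open>U\<close> at height \<open>c\<close>\<close>
    define A where "A c = {X \<in> carrier (GH Mod N). (if c = 0 then X else X #> x) \<in> U}" for c :: int
    have A_iff: "N #> h \<in> A c \<longleftrightarrow> (if c = 0 then N #> h else N #> (h \<otimes> x)) \<in> U" if "h \<in> H" for h c
      using that x by (simp add: A_def carrier_GH_Mod coset_mult_assoc N.subset)
    have "openin ?QH (A c)" for c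
    proof -
      have "openin T {g \<in> carrier G. (if c = 0 then N #> g else N #> (g \<otimes> x)) \<in> U}"
        using U(2) openin_continuous_map_preimage[OF right_mult U(2)] x(1)
        by (cases "c = 0") (simp_all cong: conj_cong)
      then have "openin TH (H \<inter> {g \<in> carrier G. (if c = 0 then N #> g else N #> (g \<otimes> x)) \<in> U})"
        by (rule openin_subtopology_Int2)
      also have "H \<inter> {g \<in> carrier G. (if c = 0 then N #> g else N #> (g \<otimes> x)) \<in> U} =
          {h \<in> carrier GH. N #>\<^bsub>GH\<^esub> h \<in> A c}"
        using HS.subset by (auto simp: A_iff)
      finally show ?thesis
        by (auto simp: openin_quotient_group_topology[OF TH] A_def FactGroup_def)
    qed
    then have "openin (prod_topology ?QH C2_top) (A 0 \<times> {0} \<union> A 1 \<times> {1})"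
      by (intro openin_Un) (simp_all add: openin_prod_Times_iff carrier_C2)
    moreover have "split_map ` U = A 0 \<times> {0} \<union> A 1 \<times> {1}"
    proof
      show "split_map ` U \<subseteq> A 0 \<times> {0} \<union> A 1 \<times> {1}"
      proof
        fix p assume "p \<in> split_map ` U"
        then obtain g where g: "g \<in> carrier G" "N #> g \<in> U" "p = split_map (N #> g)"
          using U(1) by (auto simp: carrier_FactGroup)
        then show "p \<in> A 0 \<times> {0} \<union> A 1 \<times> {1}"
          using x by (simp add: split A_def carrier_GH_Mod mult_x_mem_iff coset_mult_assoc N.subset mult_x_x)
      qed
      show "A 0 \<times> {0} \<union> A 1 \<times> {1} \<subseteq> split_map ` U"
      proof
        fix p :: "'a set \<times> int" assume "p \<in> A 0 \<times> {0} \<union> A 1 \<times> {1}"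
        then consider h where "h \<in> H" "N #> h \<in> U" "p = (N #> h, 0)"
          | h where "h \<in> H" "N #> (h \<otimes> x) \<in> U" "p = (N #> h, 1)"
          using x by (auto simp: A_def carrier_GH_Mod coset_mult_assoc N.subset)
        then show "p \<in> split_map ` U"
        proof cases
          case 1
          then have "p = split_map (N #> h)" by (simp add: split)
          with 1(2) show ?thesis by blast
        next
          case 2
          then have "h \<otimes> x \<notin> H" using mult_x_mem_iff[of h] by simp
          then have "p = split_map (N #> (h \<otimes> x))"
            using 2 x by (simp add: split mult_x_x)
          with 2(2) show ?thesis by blast
        qed
      qed
    qed
    ultimately show "openin (prod_topology ?QH C2_top) (split_map ` U)" by simp
  qed
  moreover have "split_map ` topspace ?QG = topspace (prod_topology ?QH C2_top)"
    "inj_on split_map (topspace ?QG)"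
    using split_map_iso[OF N] by (auto simp: QG QH iso_def bij_betw_def semidirect_product_def)
  ultimately show ?thesis
    by (intro bijective_open_imp_homeomorphic_map)
qed

theorem topologically_isomorphic_semidirect_product:
  assumes "N \<lhd> G" "N \<subseteq> H"
  shows "topologically_isomorphic (G Mod N) (quotient_group_topology G T N)
    (semidirect_product (GH Mod N) (conj_action N) C2)
    (prod_topology (quotient_group_topology GH TH N) C2_top)"
  unfolding topologically_isomorphic_def
  using split_map_iso[OF assms] split_map_homeomorphic[OF assms] by blast

end

section \<open>The free product of copies of the group of order two\<close>

lemma C2_character:
  assumes free: "pro2_free_product TYPE(nat set) I (\<lambda>_. C2) (\<lambda>_. C2_top) \<iota> G T"
  obtains k where "k \<in> continuous_hom G T C2 C2_top" "\<And>i. i \<in> I \<Longrightarrow> k (\<iota> i 1) = 1"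
proof -
  have "(\<lambda>a. a) \<in> continuous_hom C2 C2_top C2 C2_top"
    by (simp add: continuous_hom_def hom_def)
  moreover have "order C2 = 2 ^ 1"
    by (simp add: order_def carrier_C2)
  ultimately have "\<exists>!g. g \<in> extensional (carrier G) \<and> g \<in> continuous_hom G T C2 C2_top \<and>
      (\<forall>i\<in>I. \<forall>a\<in>carrier C2. g (\<iota> i a) = (\<lambda>i a. a) i a)"
    using free by (intro free_product_universal_finite[where k = 1]) simp_all
  then show thesis
    using that by (auto simp: carrier_C2)
qed

text \<open>
  The union of \<open>H\<close> and its coset by \<open>x 0\<close> is a closed subgroup that contains all \<open>x i\<close>, hence is
  \<open>G\<close>.  The two cosets are different because the character of \<open>G\<close> that maps every \<open>x i\<close> to the
  generator is trivial on \<open>H\<close> and nontrivial at \<open>x 0\<close>.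
\<close>

theorem free_product_index_two_split:
  fixes G (structure) and d :: nat
  assumes free: "pro2_free_product TYPE(nat set) {0..d} (\<lambda>_. C2) (\<lambda>_. C2_top) \<iota> G T"
    and x_def: "\<And>i. x i = \<iota> i 1"
    and y_def: "\<And>i. y i = x 0 \<otimes>\<^bsub>G\<^esub> x i"
    and H_def: "H = closed_subgroup_generated G T (y ` {1..d})"
  shows "index_two_split G T H (x 0)"
    and "y ` {1..d} \<subseteq> H"
    and "\<And>i. i \<in> {1..d} \<Longrightarrow> x 0 \<otimes> y i \<otimes> x 0 = inv (y i)"
proof -
  interpret compact_group G T
    using free by (intro pro2_group_imp_compact_group) (simp add: pro2_free_product_def)
  have \<iota>: "\<iota> i \<in> continuous_hom C2 C2_top G T" if "i \<le> d" for i
    using free that unfolding pro2_free_product_def by auto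
  have \<iota>_hom: "group_hom C2 G (\<iota> i)" if "i \<le> d" for i
    using \<iota>[OF that] by (simp add: continuous_hom_def group_hom_def group_hom_axioms_def is_group)
  have \<iota>_0: "\<iota> i 0 = \<one>" if "i \<le> d" for i
    using group_hom.hom_one[OF \<iota>_hom[OF that]] by simp
  have x: "x i \<in> carrier G" "x i \<otimes> x i = \<one>" if "i \<le> d" for i
    using group_hom.hom_closed[OF \<iota>_hom[OF that], of 1] group_hom.hom_mult[OF \<iota>_hom[OF that], of 1 1]
      \<iota>_0[OF that] by (simp_all add: x_def carrier_C2)
  note x0 = x[OF le0]
  have inv_x: "inv x i = x i" if "i \<le> d" for i
    using x[OF that] by (simp add: inv_equality)
  have y: "y i \<in> carrier G" if "i \<le> d" for i
    using x0 x[OF that] by (simp add: y_def)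
  have yG: "y ` {1..d} \<subseteq> carrier G" using y by auto
  have H: "closed_subgroup H"
    unfolding H_def using yG by (rule closed_subgroup_csg)
  interpret H: subgroup H G using H by simp
  show yH: "y ` {1..d} \<subseteq> H"
    unfolding H_def by (rule csg_superset)
  have x0_x0: "x 0 \<otimes> (x 0 \<otimes> a) = a" if "a \<in> carrier G" for a
    using x0 that m_assoc[of "x 0" "x 0" a] by simp
  show conj_y: "x 0 \<otimes> y i \<otimes> x 0 = inv (y i)" if "i \<in> {1..d}" for i
    using that x0 x[of i] inv_x[of 0] inv_x[of i]
    by (simp add: y_def inv_mult_group x0_x0 flip: m_assoc)
  have conj_H: "x 0 \<otimes> h \<otimes> x 0 \<in> H" if "h \<in> H" for h
  proof -
    have "(\<lambda>a. x 0 \<otimes> a \<otimes> x 0) \<in> continuous_hom G T G T"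
      using conjugation_continuous_hom[OF x0(1)] inv_x[of 0] by simp
    then have "closed_subgroup {a \<in> carrier G. x 0 \<otimes> a \<otimes> x 0 \<in> H}"
      using closed_subgroup_vimage is_group H by blast
    moreover have "y ` {1..d} \<subseteq> {a \<in> carrier G. x 0 \<otimes> a \<otimes> x 0 \<in> H}"
      using yH yG conj_y by auto
    ultimately have "H \<subseteq> {a \<in> carrier G. x 0 \<otimes> a \<otimes> x 0 \<in> H}"
      unfolding H_def by (intro csg_least)
    then show ?thesis using that by blast
  qed
  have "x 0 \<notin> H"
  proof -
    obtain k where k: "k \<in> continuous_hom G T C2 C2_top" "\<And>i. i \<in> {0..d} \<Longrightarrow> k (\<iota> i 1) = 1"
      using C2_character[OF free] by blast
    interpret k: group_hom G C2 k
      using k(1) by (simp add: continuous_hom_def group_hom_def group_hom_axioms_def is_group)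
    have "closed_subgroup {a \<in> carrier G. k a \<in> {0}}"
      using k(1) group_integer_mod_group
    proof (rule closed_subgroup_vimage)
      show "subgroup {0} C2"
        using k.H.triv_subgroup by simp
    qed (simp add: carrier_C2)
    moreover have "k (y i) = 0" if "i \<le> d" for i
      using k(2)[of 0] k(2)[of i] x0 x[OF that] that by (simp add: y_def x_def)
    then have "y ` {1..d} \<subseteq> {a \<in> carrier G. k a \<in> {0}}"
      using yG by auto
    ultimately have "H \<subseteq> {a \<in> carrier G. k a \<in> {0}}"
      unfolding H_def by (intro csg_least)
    then show ?thesis
      using k(2)[of 0] by (auto simp: x_def)
  qed
  moreover have "{g \<in> carrier G. g \<in> H \<or> g \<otimes> x 0 \<in> H} = carrier G" (is "?K = _")
    using free
  proof (rule free_product_topologically_generated)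
    show "subgroup ?K G"
    proof (rule subgroupI)
      show "?K \<noteq> {}" using H.one_closed by blast
    next
      fix g assume "g \<in> ?K"
      then consider "g \<in> H" | "g \<in> carrier G" "g \<otimes> x 0 \<in> H" by blast
      then show "inv g \<in> ?K"
      proof cases
        case 2
        have "x 0 \<otimes> inv (g \<otimes> x 0) \<otimes> x 0 \<in> H"
          using conj_H H.m_inv_closed[OF 2(2)] .
        also have "x 0 \<otimes> inv (g \<otimes> x 0) \<otimes> x 0 = inv g \<otimes> x 0"
          using 2(1) x0 inv_x[of 0] by (simp add: inv_mult_group x0_x0 m_assoc)
        finally show ?thesis using 2(1) by simp
      qed simp
    next
      fix g g' assume "g \<in> ?K" "g' \<in> ?K"
      then have G [simp]: "g \<in> carrier G" "g' \<in> carrier G"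
        and cases: "g \<in> H \<or> g \<otimes> x 0 \<in> H" "g' \<in> H \<or> g' \<otimes> x 0 \<in> H" by auto
      consider "g \<in> H" "g' \<in> H" | "g \<in> H" "g' \<otimes> x 0 \<in> H"
        | "g \<otimes> x 0 \<in> H" "g' \<in> H" | "g \<otimes> x 0 \<in> H" "g' \<otimes> x 0 \<in> H"
        using cases by blast
      then show "g \<otimes> g' \<in> ?K"
      proof cases
        case 2
        then have "g \<otimes> (g' \<otimes> x 0) \<in> H" by simp
        then show ?thesis using x0 by (simp add: m_assoc)
      next
        case 3
        then have "g \<otimes> x 0 \<otimes> (x 0 \<otimes> g' \<otimes> x 0) \<in> H" using conj_H by simp
        then show ?thesis using x0 by (simp add: m_assoc x0_x0)
      next
        case 4
        then have "g \<otimes> x 0 \<otimes> (x 0 \<otimes> (g' \<otimes> x 0) \<otimes> x 0) \<in> H" using conj_H by simp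
        then show ?thesis using x0 by (simp add: m_assoc x0_x0)
      qed simp
    qed auto
    have "continuous_map T T (\<lambda>g. g \<otimes> x 0)"
      using x0 by (intro continuous_map_mult) auto
    then have "closedin T {g \<in> carrier G. g \<otimes> x 0 \<in> H}"
      using H closedin_continuous_map_preimage[of T T _ H] by simp
    moreover have "?K = H \<union> {g \<in> carrier G. g \<otimes> x 0 \<in> H}"
      using H.subset by auto
    ultimately show "closedin T ?K"
      using H by (simp add: closedin_Un)
  next
    fix i a assume i: "i \<in> {0..d}" and "a \<in> carrier C2"
    then consider "a = 0" | "a = 1" by (auto simp: carrier_C2)
    then show "\<iota> i a \<in> ?K"
    proof cases
      case 1
      then show ?thesis using \<iota>_0 i by simp
    next
      case 2
      have "x i \<otimes> x 0 \<in> H"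
      proof (cases "i = 0")
        case True
        then show ?thesis using x0 by simp
      next
        case False
        then have "i \<in> {1..d}" using i by simp
        then have "inv (y i) \<in> H" using yH by blast
        then show ?thesis
          using i x0 x[of i] inv_x[of 0] inv_x[of i] by (simp add: y_def inv_mult_group)
      qed
      then show ?thesis using 2 i x[of i] by (simp add: x_def)
    qed
  qed
  ultimately show "index_two_split G T H (x 0)"
    using H x0 conj_H compact_group_axioms
    unfolding index_two_split_def index_two_split_axioms_def by blast
qed

theorem corollary4p8:
  fixes G :: "'a monoid" and T :: "'a topology"
    and \<iota> :: "nat \<Rightarrow> int \<Rightarrow> 'a" and x y :: "nat \<Rightarrow> 'a"
    and H :: "'a set" and GH :: "'a monoid" and TH :: "'a topology"
    and Gn Hn :: "'a set" and d n :: nat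
  assumes free: "pro2_free_product TYPE(nat set) {0..d} (\<lambda>_. C2) (\<lambda>_. C2_top) \<iota> G T"
    and x_def: "\<And>i. x i = \<iota> i 1"
    and y_def: "\<And>i. y i = x 0 \<otimes>\<^bsub>G\<^esub> x i"
    and H_def: "H = closed_subgroup_generated G T (y ` {1..d})"
    and GH_def: "GH = G\<lparr>carrier := H\<rparr>"
    and TH_def: "TH = subtopology T H"
    and n: "n \<ge> 2"
    and Gn_def: "Gn = zassenhaus_filtration G T n"
    and Hn_def: "Hn = zassenhaus_filtration GH TH n"
  shows "Hn = H \<inter> Gn \<and>
    (\<exists>\<phi>. \<phi> \<in> hom C2 (AutoGroup (GH Mod Hn)) \<and>
             (\<forall>i\<in>{1..d}. \<phi> 1 (Hn #>\<^bsub>GH\<^esub> y i) = inv\<^bsub>GH Mod Hn\<^esub> (Hn #>\<^bsub>GH\<^esub> y i)) \<and>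
             topologically_isomorphic
               (G Mod Gn) (quotient_group_topology G T Gn)
               (semidirect_product (GH Mod Hn) \<phi> C2)
               (prod_topology (quotient_group_topology GH TH Hn) C2_top))"
proof -
  note split = free_product_index_two_split[OF free x_def y_def H_def]
  interpret S: index_two_split G T H "x 0" by (rule split(1))
  have y: "y i \<in> H" if "i \<in> {1..d}" for i using split(2) that by blast
  \<comment> \<open>on the generators \<open>y i\<close> of \<open>H\<close> the left-hand side is a square\<close>
  have triv: "(x 0 \<otimes>\<^bsub>G\<^esub> h \<otimes>\<^bsub>G\<^esub> x 0) \<otimes>\<^bsub>G\<^esub> inv\<^bsub>G\<^esub> h \<in> S.HH.Z 2" if h: "h \<in> H" for h
  proof -
    let ?D = "{a \<in> carrier S.GH. x 0 \<otimes>\<^bsub>G\<^esub> a \<otimes>\<^bsub>G\<^esub> x 0 \<otimes>\<^bsub>S.GH\<^esub> inv\<^bsub>S.GH\<^esub> a \<in> S.HH.Z 2}"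
    have "S.HH.closed_subgroup ?D"
      using S.HH.closed_subgroup_fixed_mod[OF S.conj_continuous_hom] S.HH.closed_normal_Z by blast
    then have "S.closed_subgroup ?D"
      using S.closed_subgroup_trans[OF S.H] by blast
    moreover have "y i \<in> ?D" if i: "i \<in> {1..d}" for i
    proof -
      have "inv\<^bsub>G\<^esub> y i \<otimes>\<^bsub>S.GH\<^esub> inv\<^bsub>G\<^esub> y i \<in> S.HH.Z 2"
        using y[OF i] by (intro S.HH.square_mem_Z) (simp_all add: S.HH.Z_le_1)
      then show ?thesis
        using y[OF i] split(3)[OF i] S.H by simp
    qed
    ultimately have "H \<subseteq> ?D"
      by (subst H_def, intro S.csg_least) auto
    then have "h \<in> ?D" using h by blast
    then show ?thesis using S.H h by simp
  qed
  have Gn: "Gn = Hn"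
    unfolding Gn_def Hn_def GH_def TH_def using triv n by (rule S.Z_eq_Z_GH)
  have Hn: "Hn \<subseteq> H"
    using S.HH.Z_subset by (simp add: Hn_def GH_def TH_def)
  have normal: "Hn \<lhd> G"
    using S.closed_normal_Z by (simp add: Gn[symmetric] Gn_def)
  interpret N: normal Hn S.GH using S.normal_GH[OF normal Hn] .
  have "S.conj_action Hn 1 (Hn #>\<^bsub>G\<^esub> y i) = inv\<^bsub>S.GH Mod Hn\<^esub> (Hn #>\<^bsub>G\<^esub> y i)" if i: "i \<in> {1..d}" for i
  proof -
    have "Hn #>\<^bsub>G\<^esub> y i \<in> carrier (S.GH Mod Hn)"
      using y[OF i] by (simp add: S.carrier_GH_Mod)
    then have "inv\<^bsub>S.GH Mod Hn\<^esub> (Hn #>\<^bsub>G\<^esub> y i) = set_inv\<^bsub>S.GH\<^esub> (Hn #>\<^bsub>G\<^esub> y i)"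
      by (rule N.inv_FactGroup)
    also have "\<dots> = Hn #>\<^bsub>G\<^esub> inv\<^bsub>G\<^esub> y i"
      using N.rcos_inv[of "y i"] y[OF i] S.H by simp
    also have "\<dots> = S.conj_action Hn 1 (Hn #>\<^bsub>G\<^esub> y i)"
      using S.conj_action_coset[OF normal y[OF i]] split(3)[OF i] by simp
    finally show ?thesis by simp
  qed
  then show ?thesis
    using S.conj_action_hom[OF normal Hn] S.topologically_isomorphic_semidirect_product[OF normal Hn] Hn
    unfolding Gn GH_def TH_def by (intro conjI exI[of _ "S.conj_action Hn"]) auto
qed

end
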